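(* Let $(a_n)_{n \geq 1}$ be a strictly increasing sequence of positive integers for which $a_n \ll e^{\gamma (\log n)^2}$ for some $\gamma > 0$ and $$E(\{a_1, \ldots, a_N\}) = \mathcal{O}(N^{2+\varepsilon}) \quad \text{for all } \varepsilon > 0,$$ where $E$ denotes the additive energy. Then for (Lebesgue) almost all $\alpha \in \mathbb{R}$ the star-discrepancy $D_N^* = D_N^*(\{a_1\alpha\}, \ldots, \{a_N\alpha\})$ of $(\{a_n \alpha\})_{n \geq 1}$ satisfies $N D_N^* = \mathcal{O}(N^{\frac12 + \varepsilon})$ and $N D_N^* = \Omega(N^{\frac12 - \varepsilon})$ for all $\varepsilon > 0$.
   Context: $\{x\}$ denotes the fractional part of a real number $x$. For points $x_1, \ldots, x_N \in [0,1)$ the star-discrepancy is $D_N^*(x_1,\ldots,x_N) := \sup_{0 < \beta \leq 1} \left| \frac{A_N(\beta)}{N} - \beta \right|$, where $A_N(\beta) := \#\{1 \leq n \leq N : x_n \in [0,\beta)\}$. The additive energy of a finite set $A$ of integers is $E(A) := \#\{(x_1,x_2,x_3,x_4) \in A^4 : x_1 - x_2 = x_3 - x_4\}$. For nonnegative quantities, $f(N) \ll g(N)$, equivalently $f(N) = \mathcal{O}(g(N))$, means that there is a constant $C$ with $f(N) \leq C g(N)$ for all $N \ge 1$, and $f(N) = \Omega(g(N))$ means that there is a constant $c > 0$ with $f(N) \geq c\, g(N)$ for infinitely many $N$. Implied constants may depend on $\varepsilon$ and, in the conclusion, on $\alpha$. *)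

theory Defs
  imports "HOL-Analysis.Analysis"
begin

definition additive_energy :: "int set \<Rightarrow> nat" where
  "additive_energy A =
     card {(x1, x2, x3, x4). x1 \<in> A \<and> x2 \<in> A \<and> x3 \<in> A \<and> x4 \<in> A \<and> x1 - x2 = x3 - x4}"

definition count_below :: "nat \<Rightarrow> (nat \<Rightarrow> real) \<Rightarrow> real \<Rightarrow> nat" where
  "count_below N x \<beta> = card {n. 1 \<le> n \<and> n \<le> N \<and> x n \<in> {0..<\<beta>}}"

(* Meant for N >= 1 and points x 1, ..., x N in [0,1). The supremum is over a set of reals
   contained in [0,1], hence genuine. *)
definition star_discrepancy :: "nat \<Rightarrow> (nat \<Rightarrow> real) \<Rightarrow> real" where
  "star_discrepancy N x = (SUP \<beta>\<in>{0<..1}. \<bar>real (count_below N x \<beta>) / real N - \<beta>\<bar>)"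

(* Big-O for nonnegative quantities with a bound for every N >= 1, not just eventually. *)
definition bigO_all :: "(nat \<Rightarrow> real) \<Rightarrow> (nat \<Rightarrow> real) \<Rightarrow> bool" where
  "bigO_all f g \<longleftrightarrow> (\<exists>C. \<forall>N\<ge>1. f N \<le> C * g N)"

(* Omega in the sense of Hardy and Littlewood: the lower bound is required for infinitely many N
   only, unlike the Omega of HOL-Library.Landau_Symbols, which requires it eventually. *)
definition Omega_inf :: "(nat \<Rightarrow> real) \<Rightarrow> (nat \<Rightarrow> real) \<Rightarrow> bool" where
  "Omega_inf f g \<longleftrightarrow> (\<exists>c>0. \<exists>\<^sub>\<infinity>N. f N \<ge> c * g N)"

end

theory Submission
  imports Defs "HOL-Real_Asymp.Real_Asymp"
begin

text \<open>
  Write \<open>S\<^sub>N(\<alpha>)\<close> for the sum of \<open>e(a\<^sub>n \<alpha>)\<close> over \<open>n \<le> N\<close>, with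
  \<open>e(x) = exp(2 \<pi> i x)\<close>.

  Upper bound: by the inequality of Erdos and Turan with \<open>H\<close> of order \<open>N\<close> it suffices to bound the
  sum of \<open>\<bar>S\<^sub>N(h \<alpha>)\<bar> / h\<close> over \<open>h \<le> H\<close>. For each \<open>h\<close> the functions \<open>e(h a\<^sub>n \<alpha>)\<close> are
  orthonormal on unit intervals, so the dyadic decomposition of Rademacher and Menshov controls all
  \<open>N \<le> 2\<^sup>k\<close> at once in mean square, up to powers of \<open>k\<close>, and summability over \<open>k\<close> gives the almost
  everywhere bound.

  Lower bound: by Koksma's inequality \<open>N D\<^sub>N\<close> is at least \<open>\<bar>S\<^sub>N(p \<alpha>)\<bar> / (2 \<pi> p)\<close>, so it suffices
  that \<open>\<bar>S\<^sub>N(p \<alpha>)\<bar>\<^sup>2 \<ge> N / 2\<close> for some prime \<open>p \<le> H = N\<^sup>1\<^sup>/\<^sup>q\<close>. The function \<open>\<bar>S\<^sub>N\<bar>\<^sup>2 - N\<close> has square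
  integral at most the additive energy, and its frequencies are of size at most \<open>exp(\<gamma> (log N)\<^sup>2)\<close>.
  An integer of that size has only \<open>O((log N)\<^sup>2)\<close> prime divisors, so the dilations of this function
  by the primes \<open>p \<le> H\<close> are nearly uncorrelated, and the mean of \<open>\<bar>S\<^sub>N(p \<alpha>)\<bar>\<^sup>2\<close> over these primes
  is close to \<open>N\<close> for almost all \<open>\<alpha>\<close> once \<open>N = 2\<^sup>q\<^sup>j\<close> is large.
\<close>

section \<open>Exponential sums and the sawtooth function\<close>

abbreviation e1 :: "real \<Rightarrow> complex" where
  "e1 x \<equiv> cis (2 * pi * x)"

lemma e1_add: "e1 (x + y) = e1 x * e1 y"
  by (simp add: cis_mult algebra_simps)

lemma e1_of_int [simp]: "e1 (real_of_int m) = 1"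
  by (rule cis_multiple_2pi) auto

lemma e1_cong: "x - y \<in> \<int> \<Longrightarrow> e1 x = e1 y"
  using e1_add[of y "x - y"] by (auto elim!: Ints_cases)

lemma has_vector_derivative_e1:
  "((\<lambda>t. e1 (c * t)) has_vector_derivative (2 * pi * \<i> * c) * e1 (c * t)) (at t within A)"
  unfolding has_vector_derivative_def
  by (rule has_derivative_eq_rhs, (rule derivative_intros)+)
     (auto simp: fun_eq_iff scaleR_conv_of_real algebra_simps)

text \<open>For nonzero \<open>m\<close> the primitive is 1-periodic, so its increment vanishes.
  Every unit interval is allowed because the almost everywhere statements below cover the line by
  such intervals.\<close>

lemma e1_has_integral:
  fixes m :: int
  shows "((\<lambda>x. e1 (of_int m * x)) has_integral (if m = 0 then 1 else 0)) {t..t + 1}"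
proof (cases "m = 0")
  case True
  then show ?thesis using has_integral_const_real[of "1::complex" t "t+1"] by simp
next
  case False
  define w where "w = 2 * pi * \<i> * of_int m"
  have w: "w \<noteq> 0" using False by (simp add: w_def)
  have "((\<lambda>x. e1 (of_int m * x)) has_integral
      (e1 (of_int m * (t + 1)) / w - e1 (of_int m * t) / w)) {t..t + 1}"
  proof (rule fundamental_theorem_of_calculus)
    fix x
    have "((\<lambda>x. e1 (of_int m * x) / w) has_vector_derivative
        ((2 * pi * \<i> * of_int m) * e1 (of_int m * x)) / w) (at x within {t..t + 1})"
      using has_vector_derivative_e1[of "of_int m" x]
      by (intro has_vector_derivative_divide) auto
    then show "((\<lambda>x. e1 (of_int m * x) / w) has_vector_derivative e1 (of_int m * x))
        (at x within {t..t + 1})"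
      using w by (simp add: w_def)
  qed auto
  moreover have "e1 (of_int m * (t + 1)) = e1 (of_int m * t)"
    by (rule e1_cong) (simp add: algebra_simps)
  ultimately show ?thesis using False by simp
qed

text \<open>Expanding the square leaves the pairs of equal frequencies, to which AM-GM applies.\<close>
lemma integral_norm_exp_sum_le:
  fixes c :: "'i \<Rightarrow> real" and l :: "'i \<Rightarrow> int"
  assumes I: "finite I" and mult: "\<And>v. v \<in> l ` I \<Longrightarrow> real (card {i \<in> I. l i = v}) \<le> K"
  shows "integral {t..t + 1} (\<lambda>x. (norm (\<Sum>i\<in>I. c i * e1 (of_int (l i) * x)))\<^sup>2) \<le> K * (\<Sum>i\<in>I. (c i)\<^sup>2)"
proof -
  define f where "f = (\<lambda>x. \<Sum>i\<in>I. c i * e1 (of_int (l i) * x))"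
  have eq: "complex_of_real ((norm (f x))\<^sup>2) =
      (\<Sum>i\<in>I. \<Sum>k\<in>I. c i * c k * e1 (of_int (l i - l k) * x))" for x
  proof -
    have "complex_of_real ((norm (f x))\<^sup>2) = f x * cnj (f x)"
      by (simp only: complex_norm_square)
    also have "\<dots> = (\<Sum>i\<in>I. \<Sum>k\<in>I. (c i * e1 (of_int (l i) * x)) * cnj (c k * e1 (of_int (l k) * x)))"
      by (simp add: f_def sum_product del: complex_cnj_mult)
    also have "\<dots> = (\<Sum>i\<in>I. \<Sum>k\<in>I. c i * c k * e1 (of_int (l i - l k) * x))"
    proof (intro sum.cong refl)
      fix i k
      have "e1 (of_int (l i) * x) * cnj (e1 (of_int (l k) * x)) = e1 (of_int (l i - l k) * x)"
        by (simp add: cis_cnj cis_mult algebra_simps)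
      then show "(c i * e1 (of_int (l i) * x)) * cnj (c k * e1 (of_int (l k) * x))
          = c i * c k * e1 (of_int (l i - l k) * x)"
        by (simp add: mult_ac)
    qed
    finally show ?thesis .
  qed
  have "((\<lambda>x. complex_of_real ((norm (f x))\<^sup>2)) has_integral
      (\<Sum>i\<in>I. \<Sum>k\<in>I. complex_of_real (c i * c k) * (if l i - l k = 0 then 1 else 0))) {t..t + 1}"
    unfolding eq
    by (intro has_integral_sum I has_integral_mult_right e1_has_integral)
  from has_integral_linear[OF this bounded_linear_Re]
  have "((\<lambda>x. (norm (f x))\<^sup>2) has_integral
      Re (\<Sum>i\<in>I. \<Sum>k\<in>I. complex_of_real (c i * c k) * (if l i - l k = 0 then 1 else 0))) {t..t + 1}"
    by (simp add: o_def)
  then have "integral {t..t + 1} (\<lambda>x. (norm (f x))\<^sup>2) =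
      Re (\<Sum>i\<in>I. \<Sum>k\<in>I. complex_of_real (c i * c k) * (if l i - l k = 0 then 1 else 0))"
    by (rule integral_unique)
  also have "\<dots> = (\<Sum>i\<in>I. \<Sum>k\<in>I. if l k = l i then c i * c k else 0)"
    by (auto simp: intro!: sum.cong)
  also have "\<dots> \<le> (\<Sum>i\<in>I. \<Sum>k\<in>I. if l k = l i then (c i)\<^sup>2 / 2 + (c k)\<^sup>2 / 2 else 0)"
  proof (intro sum_mono)
    fix i k
    have "2 * c i * c k \<le> (c i)\<^sup>2 + (c k)\<^sup>2" by (rule sum_squares_bound)
    then show "(if l k = l i then c i * c k else 0)
        \<le> (if l k = l i then (c i)\<^sup>2 / 2 + (c k)\<^sup>2 / 2 else 0)" by simp
  qed
  also have "\<dots> = (\<Sum>i\<in>I. \<Sum>k\<in>I. if l k = l i then (c i)\<^sup>2 / 2 else 0)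
      + (\<Sum>i\<in>I. \<Sum>k\<in>I. if l k = l i then (c k)\<^sup>2 / 2 else 0)"
    unfolding sum.distrib[symmetric] by (intro sum.cong refl) auto
  also have "(\<Sum>i\<in>I. \<Sum>k\<in>I. if l k = l i then (c k)\<^sup>2 / 2 else 0)
      = (\<Sum>i\<in>I. \<Sum>k\<in>I. if l k = l i then (c i)\<^sup>2 / 2 else 0)"
    by (subst sum.swap) (intro sum.cong refl, auto)
  also have "(\<Sum>i\<in>I. \<Sum>k\<in>I. if l k = l i then (c i)\<^sup>2 / 2 else 0)
      + (\<Sum>i\<in>I. \<Sum>k\<in>I. if l k = l i then (c i)\<^sup>2 / 2 else 0)
      = (\<Sum>i\<in>I. real (card {k \<in> I. l k = l i}) * (c i)\<^sup>2)"
  proof -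
    have "(\<Sum>k\<in>I. if l k = l i then (c i)\<^sup>2 / 2 else 0)
        = real (card {k \<in> I. l k = l i}) * ((c i)\<^sup>2 / 2)" for i
      by (subst sum.inter_filter[OF I, symmetric]) simp
    then have "(\<Sum>i\<in>I. \<Sum>k\<in>I. if l k = l i then (c i)\<^sup>2 / 2 else 0)
        = (\<Sum>i\<in>I. real (card {k \<in> I. l k = l i}) * (c i)\<^sup>2) / 2"
      unfolding sum_divide_distrib by (intro sum.cong refl) (simp only: times_divide_eq_right)
    then show ?thesis by (simp only: field_sum_of_halves)
  qed
  also have "\<dots> \<le> (\<Sum>i\<in>I. K * (c i)\<^sup>2)"
    by (intro sum_mono mult_right_mono mult) auto
  finally show ?thesis by (simp add: f_def sum_distrib_left)
qed

section \<open>Fourier coefficients of the sawtooth function\<close>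

text \<open>The only jump of \<^term>\<open>\<lambda>t. frac (y - t)\<close> on the period is at \<^term>\<open>s + frac (y - s)\<close>; the
  fundamental theorem of calculus is applied on both sides of it.\<close>
lemma sawtooth_integral_aux:
  fixes F :: "real \<Rightarrow> real \<Rightarrow> complex" and g :: "real \<Rightarrow> complex"
  assumes deriv: "\<And>c t. ((F c) has_vector_derivative (c - t) *\<^sub>R g t) (at t)"
    and per: "\<And>c t. F (c + 1) (t + 1) = F c t"
  shows "((\<lambda>t. frac (y - t) *\<^sub>R g t) has_integral
    (F (s + frac (y - s)) (s + frac (y - s)) - F (s + frac (y - s) + 1) (s + frac (y - s)))) {s..s + 1}"
proof -
  define t0 where "t0 = s + frac (y - s)"
  have t0: "s \<le> t0" "t0 < s + 1" by (auto simp: t0_def frac_lt_1)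
  have y: "y - t0 = of_int \<lfloor>y - s\<rfloor>" by (simp add: t0_def frac_def)
  have ftc: "((\<lambda>t. (c - t) *\<^sub>R g t) has_integral (F c q - F c p)) {p..q}" if "p \<le> q" for c p q
    using that by (rule fundamental_theorem_of_calculus) (rule has_vector_derivative_at_within[OF deriv])
  have fr: "frac (y - t) = c - t" if "c - t0 \<in> \<int>" "0 \<le> c - t" "c - t < 1" for c t
  proof -
    have "(y - t) - (c - t) = (y - t0) - (c - t0)" by simp
    also have "\<dots> \<in> \<int>" using that(1) y by (metis Ints_diff Ints_of_int)
    finally show ?thesis using that(2,3) by (simp only: frac_unique_iff)
  qed
  have 1: "((\<lambda>t. frac (y - t) *\<^sub>R g t) has_integral (F t0 t0 - F t0 s)) {s..t0}"
  proof (rule has_integral_eq)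
    show "((\<lambda>t. (t0 - t) *\<^sub>R g t) has_integral (F t0 t0 - F t0 s)) {s..t0}"
      by (rule ftc) (fact t0)
    show "(t0 - t) *\<^sub>R g t = frac (y - t) *\<^sub>R g t" if "t \<in> {s..t0}" for t
      using that t0 by (subst fr[of t0]) auto
  qed
  have 2: "((\<lambda>t. frac (y - t) *\<^sub>R g t) has_integral (F (t0 + 1) (s + 1) - F (t0 + 1) t0)) {t0..s + 1}"
  proof (rule has_integral_spike)
    \<comment> \<open>At \<open>t0\<close> itself the fractional part is 0 while
      \<open>t0 + 1 - t\<close> is 1.\<close>
    show "negligible {t0}" by simp
    show "((\<lambda>t. (t0 + 1 - t) *\<^sub>R g t) has_integral (F (t0 + 1) (s + 1) - F (t0 + 1) t0)) {t0..s + 1}"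
      by (rule ftc) (use t0 in simp)
    show "frac (y - t) *\<^sub>R g t = (t0 + 1 - t) *\<^sub>R g t" if "t \<in> {t0..s + 1} - {t0}" for t
      using that t0 by (subst fr[of "t0 + 1"]) auto
  qed
  \<comment> \<open>By \<open>per\<close> the boundary terms at \<open>s\<close> and
    \<open>s + 1\<close> cancel; only the jump at \<open>t0\<close> remains.\<close>
  show ?thesis
    using has_integral_combine[OF _ _ 1 2] t0 by (simp add: per t0_def)
qed

text \<open>This is the integral of \<open>frac (- t) * e1 (h * t)\<close> over a period, the case
  \<open>y = 0\<close> of \<open>sawtooth_fourier\<close>.\<close>

definition saw_coeff :: "int \<Rightarrow> complex" where
  "saw_coeff h = (if h = 0 then 1 / 2 else \<i> / (2 * pi * h))"

lemma norm_saw_coeff: "h \<noteq> 0 \<Longrightarrow> norm (saw_coeff h) = 1 / (2 * pi * \<bar>real_of_int h\<bar>)"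
  by (simp add: saw_coeff_def norm_divide norm_mult)

lemma sawtooth_fourier:
  fixes h :: int
  shows "((\<lambda>t. frac (y - t) *\<^sub>R e1 (of_int h * t)) has_integral (saw_coeff h * e1 (of_int h * y))) {s..s + 1}"
proof (cases "h = 0")
  case True
  have "((\<lambda>t. frac (y - t) *\<^sub>R (1::complex)) has_integral
    (- complex_of_real ((s + frac (y - s) - (s + frac (y - s)))\<^sup>2 / 2)
      - - complex_of_real ((s + frac (y - s) + 1 - (s + frac (y - s)))\<^sup>2 / 2))) {s..s + 1}"
  proof (rule sawtooth_integral_aux)
    fix c t :: real
    have "((\<lambda>t. - ((c - t)\<^sup>2 / 2)) has_real_derivative (c - t)) (at t)"
      by (auto intro!: derivative_eq_intros simp: field_simps)
    from has_vector_derivative_of_real[OF this, where 'a = complex]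
    show "((\<lambda>t. - complex_of_real ((c - t)\<^sup>2 / 2)) has_vector_derivative (c - t) *\<^sub>R 1) (at t)"
      by (simp add: scaleR_conv_of_real)
  qed simp
  then show ?thesis using True by (simp add: saw_coeff_def scaleR_conv_of_real)
next
  case False
  define w where "w = 2 * pi * \<i> * of_int h"
  have w: "w \<noteq> 0" using False by (simp add: w_def)
  define t0 where "t0 = s + frac (y - s)"
  \<comment> \<open>The antiderivative comes from integration by parts: the derivative of the term
    with \<open>w ^ 2\<close> cancels what differentiating the factor \<open>c - t\<close> leaves
    over.\<close>
  have integral: "((\<lambda>t. frac (y - t) *\<^sub>R e1 (of_int h * t)) has_integral
    ((complex_of_real (t0 - t0) * e1 (of_int h * t0) / w + e1 (of_int h * t0) / w ^ 2)
      - (complex_of_real (t0 + 1 - t0) * e1 (of_int h * t0) / w + e1 (of_int h * t0) / w ^ 2))) {s..s + 1}"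
    unfolding t0_def
  proof (rule sawtooth_integral_aux)
    fix c t :: real
    have "((\<lambda>t. c - t) has_real_derivative - 1) (at t)"
      by (auto intro!: derivative_eq_intros)
    from has_vector_derivative_of_real[OF this, where 'a = complex]
    have d1: "((\<lambda>t. complex_of_real (c - t)) has_vector_derivative - 1) (at t)"
      by simp
    note d2 = has_vector_derivative_e1[of "of_int h" t UNIV]
    have "((\<lambda>t. complex_of_real (c - t) * e1 (of_int h * t) / w + e1 (of_int h * t) / w ^ 2)
        has_vector_derivative ((complex_of_real (c - t) * (2 * pi * \<i> * of_int h * e1 (of_int h * t))
          + -1 * e1 (of_int h * t)) / w + (2 * pi * \<i> * of_int h * e1 (of_int h * t)) / w ^ 2)) (at t)"
      using has_vector_derivative_add[OF has_vector_derivative_divide[OF has_vector_derivative_mult[OF d1 d2]]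
          has_vector_derivative_divide[OF d2], of w "w ^ 2"]
      by simp
    moreover have "((complex_of_real (c - t) * (2 * pi * \<i> * of_int h * e1 (of_int h * t))
          + -1 * e1 (of_int h * t)) / w + (2 * pi * \<i> * of_int h * e1 (of_int h * t)) / w ^ 2)
          = (c - t) *\<^sub>R e1 (of_int h * t)"
    proof -
      have "(x * (w * e) + -1 * e) / w + w * e / w ^ 2 = x * e" for x e
        using w by (simp add: add_divide_distrib diff_divide_distrib power2_eq_square)
      then show ?thesis unfolding w_def[symmetric] scaleR_conv_of_real .
    qed
    ultimately show "((\<lambda>t. complex_of_real (c - t) * e1 (of_int h * t) / w + e1 (of_int h * t) / w ^ 2)
        has_vector_derivative (c - t) *\<^sub>R e1 (of_int h * t)) (at t)"
      by simp
  next
    fix c t :: real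
    have "e1 (of_int h * (t + 1)) = e1 (of_int h * t)"
      by (rule e1_cong) (simp add: algebra_simps)
    then show "complex_of_real (c + 1 - (t + 1)) * e1 (of_int h * (t + 1)) / w + e1 (of_int h * (t + 1)) / w\<^sup>2
        = complex_of_real (c - t) * e1 (of_int h * t) / w + e1 (of_int h * t) / w\<^sup>2"
      by simp
  qed
  have "e1 (of_int h * t0) = e1 (of_int h * y)"
  proof (rule e1_cong)
    have "of_int h * t0 - of_int h * y = of_int (- h * \<lfloor>y - s\<rfloor>)"
      by (simp add: t0_def frac_def algebra_simps)
    then show "of_int h * t0 - of_int h * y \<in> \<int>" by (metis Ints_of_int)
  qed
  moreover have "saw_coeff h = - 1 / w"
    using False by (simp add: w_def saw_coeff_def field_simps)
  ultimately have "((complex_of_real (t0 - t0) * e1 (of_int h * t0) / w + e1 (of_int h * t0) / w ^ 2)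
      - (complex_of_real (t0 + 1 - t0) * e1 (of_int h * t0) / w + e1 (of_int h * t0) / w ^ 2))
      = saw_coeff h * e1 (of_int h * y)"
    by simp
  with integral show ?thesis by (simp only:)
qed

section \<open>The inequalities of Erdos and Turan and of Koksma\<close>

definition exp_sum :: "nat \<Rightarrow> (nat \<Rightarrow> real) \<Rightarrow> int \<Rightarrow> complex" where
  "exp_sum N y h = (\<Sum>n=1..N. e1 (of_int h * y n))"

text \<open>Its differences are the local discrepancies (\<open>count_below_frac\<close>), and it is
  1-periodic in \<open>t\<close>, which opens the way to Fourier analysis.\<close>

definition saw_sum :: "nat \<Rightarrow> (nat \<Rightarrow> real) \<Rightarrow> real \<Rightarrow> real" where
  "saw_sum N y t = (\<Sum>n=1..N. frac (y n - t))"

lemma norm_exp_sum_uminus: "norm (exp_sum N y (- h)) = norm (exp_sum N y h)"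
proof -
  have "exp_sum N y (- h) = cnj (exp_sum N y h)"
    by (simp add: exp_sum_def cis_cnj)
  then show ?thesis by simp
qed

lemma saw_sum_fourier:
  "((\<lambda>t. saw_sum N y t *\<^sub>R e1 (of_int h * t)) has_integral (saw_coeff h * exp_sum N y h)) {s..s + 1}"
  unfolding saw_sum_def exp_sum_def scaleR_sum_left sum_distrib_left
  by (intro has_integral_sum sawtooth_fourier) simp

text \<open>The constant \<open>saw_sum N y 0\<close> is orthogonal to a nontrivial character, so
  the Fourier coefficient of the sawtooth sum at \<open>h\<close> is at most \<open>W\<close> in
  modulus; it remains to divide by \<open>norm (saw_coeff h)\<close>.\<close>

lemma koksma_exp_sum:
  assumes W: "\<And>t. t \<in> {0..1} \<Longrightarrow> \<bar>saw_sum N y t - saw_sum N y 0\<bar> \<le> W" and h: "h \<noteq> 0"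
  shows "norm (exp_sum N y h) \<le> 2 * pi * \<bar>real_of_int h\<bar> * W"
proof -
  have "((\<lambda>t. saw_sum N y t *\<^sub>R e1 (of_int h * t) - saw_sum N y 0 *\<^sub>R e1 (of_int h * t)) has_integral
      (saw_coeff h * exp_sum N y h - saw_sum N y 0 *\<^sub>R (if h = 0 then 1 else 0))) {0..0 + 1}"
    by (intro has_integral_diff saw_sum_fourier has_integral_cmul e1_has_integral)
  then have "((\<lambda>t. (saw_sum N y t - saw_sum N y 0) *\<^sub>R e1 (of_int h * t)) has_integral
      (saw_coeff h * exp_sum N y h)) (cbox 0 1)"
    using h by (simp add: scaleR_diff_left)
  moreover have "0 \<le> W" using W[of 0] by simp
  ultimately have "norm (saw_coeff h * exp_sum N y h) \<le> W * measure lborel (cbox 0 (1::real))"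
    using W by (intro has_integral_bound[where f = "\<lambda>t. (saw_sum N y t - saw_sum N y 0) *\<^sub>R e1 (of_int h * t)"]) auto
  then show ?thesis using h by (simp add: norm_mult norm_saw_coeff field_simps)
qed

section \<open>The Fejer kernel and its tails\<close>

definition fejer :: "nat \<Rightarrow> real \<Rightarrow> real" where
  "fejer H u = (norm (\<Sum>j<H. e1 (real j * u)))\<^sup>2 / H"

lemma fejer_nonneg: "0 \<le> fejer H u"
  by (simp add: fejer_def)

lemma fejer_conv_sum:
  "complex_of_real (fejer H u) = (\<Sum>j<H. \<Sum>l<H. (1 / H) *\<^sub>R e1 (of_int (int j - int l) * u))"
proof -
  have "complex_of_real (fejer H u) = (1 / H) *\<^sub>R
      ((\<Sum>j<H. e1 (real j * u)) * cnj (\<Sum>j<H. e1 (real j * u)))"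
    by (simp only: fejer_def of_real_divide complex_norm_square scaleR_conv_of_real) simp
  also have "\<dots> = (\<Sum>j<H. \<Sum>l<H. (1 / H) *\<^sub>R e1 (of_int (int j - int l) * u))"
    by (simp add: sum_product scaleR_sum_right cis_cnj cis_mult algebra_simps)
  finally show ?thesis .
qed

lemma fejer_has_integral:
  assumes "H \<ge> 1"
  shows "(fejer H has_integral 1) {s..s + 1}"
proof -
  have "((\<lambda>u. complex_of_real (fejer H u)) has_integral
      (\<Sum>j<H. \<Sum>l<H. (1 / H) *\<^sub>R (if int j - int l = 0 then 1 else 0))) {s..s + 1}"
    unfolding fejer_conv_sum by (intro has_integral_sum has_integral_cmul e1_has_integral) auto
  moreover have "(\<Sum>j<H. \<Sum>l<H. (1 / H) *\<^sub>R (if int j - int l = 0 then 1 else 0)) = (1::complex)"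
  proof -
    have "(\<Sum>j<H. \<Sum>l<H. (1 / H) *\<^sub>R (if int j - int l = 0 then 1 else 0)) = (\<Sum>j<H. complex_of_real (1 / H))"
      by (intro sum.cong refl) (simp add: if_distrib scaleR_conv_of_real cong: if_cong)
    then show ?thesis using assms by simp
  qed
  ultimately show ?thesis
    using has_integral_linear[OF _ bounded_linear_Re, of "\<lambda>u. complex_of_real (fejer H u)" 1] by (simp add: o_def)
qed

text \<open>The Taylor remainder \<open>|x|^3 / 6\<close> is at most \<open>2 |x| / 3\<close>,
  because \<open>pi / 2 < 2\<close>.\<close>

lemma abs_sin_ge: 
  assumes "\<bar>x\<bar> \<le> pi / 2"
  shows "\<bar>x\<bar> / 3 \<le> \<bar>sin x\<bar>"
proof -
  have "\<bar>sin x - (\<Sum>m<3. sin_coeff m * x ^ m)\<bar> \<le> inverse (fact 3) * \<bar>x\<bar> ^ 3"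
    by (rule Maclaurin_sin_bound)
  then have "\<bar>sin x - x\<bar> \<le> \<bar>x\<bar> ^ 3 / 6"
    by (simp add: numeral_3_eq_3 sin_coeff_def fact_reduce)
  moreover have "\<bar>x\<bar> ^ 3 \<le> \<bar>x\<bar> * 4"
  proof -
    have "\<bar>x\<bar> ^ 2 \<le> 2 ^ 2"
      using assms pi_less_4 by (intro power_mono) auto
    then have "\<bar>x\<bar> * \<bar>x\<bar> ^ 2 \<le> \<bar>x\<bar> * 4" by (intro mult_left_mono) auto
    then show ?thesis by (simp add: power3_eq_cube power2_eq_square mult.assoc)
  qed
  ultimately show ?thesis by linarith
qed

text \<open>Summing the geometric series bounds the kernel by \<open>1 / (H * u^2)\<close>.
  Replacing \<open>u^2\<close> by \<open>u^2 + \<delta>^2\<close> costs a factor 2 outside the core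
  and gives a majorant that is integrable across 0.\<close>

lemma fejer_tail:
  assumes "\<delta> < \<bar>u\<bar>" "\<bar>u\<bar> \<le> 1 / 2" "\<delta> > 0" "H \<ge> 1"
  shows "fejer H u \<le> 2 / (H * (u\<^sup>2 + \<delta>\<^sup>2))"
proof -
  have "\<bar>u\<bar> * pi / 3 \<le> \<bar>sin (pi * u)\<bar>"
    using abs_sin_ge[of "pi * u"] assms by (simp add: abs_mult mult.commute)
  moreover have "\<bar>u\<bar> * 3 \<le> \<bar>u\<bar> * pi" using pi_gt3 by (intro mult_left_mono) auto
  ultimately have sin_ge: "\<bar>u\<bar> \<le> \<bar>sin (pi * u)\<bar>" by linarith
  have z1: "norm (e1 u - 1) = 2 * \<bar>sin (pi * u)\<bar>"
  proof -
    have "(norm (e1 u - 1))\<^sup>2 = (cos (2 * (pi * u)) - 1)\<^sup>2 + (sin (2 * (pi * u)))\<^sup>2"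
      by (simp add: cmod_power2 mult.assoc)
    also have "\<dots> = 2 - 2 * cos (2 * (pi * u))"
      using sin_cos_squared_add[of "2 * (pi * u)"] by (simp add: power2_eq_square algebra_simps)
    also have "\<dots> = (2 * \<bar>sin (pi * u)\<bar>)\<^sup>2"
      by (simp add: cos_double_sin power_mult_distrib)
    finally show ?thesis by (subst (asm) power2_eq_iff_nonneg) auto
  qed
  have u: "\<bar>u\<bar> > 0" using assms by linarith
  have ne: "e1 u \<noteq> 1" using z1 sin_ge u by auto
  have "(\<Sum>j<H. e1 (real j * u)) = (\<Sum>j<H. e1 u ^ j)"
    by (intro sum.cong refl) (simp add: Complex.DeMoivre mult_ac)
  also have "\<dots> = (e1 u ^ H - 1) / (e1 u - 1)" by (rule geometric_sum[OF ne])
  finally have "norm (\<Sum>j<H. e1 (real j * u)) = norm (e1 u ^ H - 1) / (2 * \<bar>sin (pi * u)\<bar>)"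
    by (simp add: norm_divide z1)
  also have "\<dots> \<le> 2 / (2 * \<bar>u\<bar>)"
    using norm_triangle_ineq4[of "e1 u ^ H" 1] sin_ge u
    by (intro frac_le) (auto simp: norm_power)
  finally have "(norm (\<Sum>j<H. e1 (real j * u)))\<^sup>2 \<le> (1 / \<bar>u\<bar>)\<^sup>2"
    by (intro power_mono) auto
  then have "fejer H u \<le> (1 / \<bar>u\<bar>)\<^sup>2 / H"
    unfolding fejer_def by (intro divide_right_mono) auto
  also have "\<dots> \<le> 2 / (H * (u\<^sup>2 + \<delta>\<^sup>2))"
  proof -
    have "\<delta>\<^sup>2 \<le> u\<^sup>2" using assms by (simp add: abs_le_square_iff[symmetric])
    moreover have "u\<^sup>2 > 0" "\<delta>\<^sup>2 > 0" using u assms by auto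
    ultimately have "1 / u\<^sup>2 \<le> 2 / (u\<^sup>2 + \<delta>\<^sup>2)"
      using frac_le[of 2 2 "u\<^sup>2 + \<delta>\<^sup>2" "2 * u\<^sup>2"] by (simp add: add_pos_pos)
    then have "1 / u\<^sup>2 / H \<le> 2 / (u\<^sup>2 + \<delta>\<^sup>2) / H" by (intro divide_right_mono) auto
    then show ?thesis by (simp add: power_divide mult.commute)
  qed
  finally show ?thesis .
qed

text \<open>The primitive is a multiple of an arctangent, whose total increase is at most
  \<open>pi\<close>.\<close>

lemma fejer_tail_integral:
  fixes H :: nat and \<delta> :: real
  assumes "\<delta> > 0" "H \<ge> 1"
  obtains \<tau> where "((\<lambda>u. 2 / (H * (u\<^sup>2 + \<delta>\<^sup>2))) has_integral \<tau>) {-(1/2)..-(1/2) + 1}" "\<tau> \<le> 2 * pi / (H * \<delta>)"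
proof -
  define \<tau> where "\<tau> = 2 / (H * \<delta>) * arctan ((- (1/2) + 1) / \<delta>) - 2 / (H * \<delta>) * arctan (- (1/2) / \<delta>)"
  have "((\<lambda>u. 2 / (H * (u\<^sup>2 + \<delta>\<^sup>2))) has_integral \<tau>) {-(1/2)..-(1/2) + 1}"
    unfolding \<tau>_def
  proof (rule fundamental_theorem_of_calculus)
    fix u :: real
    have "((\<lambda>u. 2 / (H * \<delta>) * arctan (u / \<delta>)) has_real_derivative
        2 / (H * \<delta>) * (inverse (1 + (u / \<delta>)\<^sup>2) * (1 / \<delta>))) (at u within {-(1/2)..-(1/2) + 1})"
      by (rule derivative_eq_intros refl)+ (use assms in \<open>auto simp: divide_inverse\<close>)
    moreover have "2 / (H * \<delta>) * (inverse (1 + (u / \<delta>)\<^sup>2) * (1 / \<delta>)) = 2 / (H * (u\<^sup>2 + \<delta>\<^sup>2))"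
    proof -
      have "\<delta> * (1 + (u / \<delta>)\<^sup>2) * \<delta> = u\<^sup>2 + \<delta>\<^sup>2"
        using assms by (simp add: power2_eq_square field_simps)
      then show ?thesis by (simp add: divide_inverse mult_ac flip: inverse_mult_distrib)
    qed
    ultimately show "((\<lambda>u. 2 / (H * \<delta>) * arctan (u / \<delta>)) has_vector_derivative
        2 / (H * (u\<^sup>2 + \<delta>\<^sup>2))) (at u within {-(1/2)..-(1/2) + 1})"
      by (simp add: has_real_derivative_iff_has_vector_derivative)
  qed simp
  moreover
  have "arctan ((- (1/2) + 1) / \<delta>) - arctan (- (1/2) / \<delta>) \<le> pi / 2 - - (pi / 2)"
    using arctan_ubound arctan_lbound by (intro diff_mono) (auto intro: less_imp_le)
  then have "2 / (H * \<delta>) * (arctan ((- (1/2) + 1) / \<delta>) - arctan (- (1/2) / \<delta>)) \<le> 2 / (H * \<delta>) * pi"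
    using assms by (intro mult_left_mono) auto
  then have "\<tau> \<le> 2 * pi / (H * \<delta>)" by (simp add: \<tau>_def right_diff_distrib)
  ultimately show ?thesis by (rule that)
qed

text \<open>Averaging against the kernel keeps only frequencies below \<open>H\<close>. The diagonal
  terms \<open>j = l\<close> yield the mean \<open>N / 2\<close>, the others the error.\<close>

lemma fejer_saw_sum:
  assumes "H \<ge> 1"
  obtains R where "((\<lambda>u. saw_sum N y (c + u) * fejer H u) has_integral R) {s..s + 1}"
    "\<bar>R - N / 2\<bar> \<le> (\<Sum>h=1..H. norm (exp_sum N y (int h)) / h)"
proof -
  define A where "A m = saw_coeff m * exp_sum N (\<lambda>n. y n - c) m" for m
  define b where "b h = norm (exp_sum N y (int h)) / (2 * pi * h)" for h :: nat
  define Z where "Z = (\<Sum>j<H. \<Sum>l<H. (1 / H) *\<^sub>R A (int j - int l))"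
  \<comment> \<open>Translating the argument by \<open>c\<close> amounts to translating the points
    by \<open>- c\<close>, which leaves the moduli of the exponential sums unchanged.\<close>
  have shift: "saw_sum N (\<lambda>n. y n - c) u = saw_sum N y (c + u)" for u
    by (simp add: saw_sum_def algebra_simps)
  have normA: "norm (A m) = b (nat \<bar>m\<bar>)" if "m \<noteq> 0" for m
  proof -
    have "exp_sum N (\<lambda>n. y n - c) m = e1 (- (of_int m * c)) * exp_sum N y m"
      by (simp add: exp_sum_def sum_distrib_left cis_mult algebra_simps)
    moreover have "norm (exp_sum N y m) = norm (exp_sum N y (int (nat \<bar>m\<bar>)))"
      using norm_exp_sum_uminus[of N y m] by (cases "m \<ge> 0") auto
    ultimately show ?thesis using that
      by (simp add: A_def norm_mult norm_saw_coeff b_def)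
  qed
  have A0: "A 0 = of_real (N / 2)" by (simp add: A_def saw_coeff_def exp_sum_def)
  have "((\<lambda>u. \<Sum>j<H. \<Sum>l<H. (1 / H) *\<^sub>R (saw_sum N (\<lambda>n. y n - c) u *\<^sub>R e1 (of_int (int j - int l) * u)))
      has_integral Z) {s..s + 1}"
    unfolding Z_def A_def by (intro has_integral_sum has_integral_cmul saw_sum_fourier) auto
  moreover have "(\<Sum>j<H. \<Sum>l<H. (1 / H) *\<^sub>R (saw_sum N (\<lambda>n. y n - c) u *\<^sub>R e1 (of_int (int j - int l) * u)))
      = complex_of_real (saw_sum N y (c + u) * fejer H u)" for u
    unfolding shift of_real_mult fejer_conv_sum sum_distrib_left
    by (intro sum.cong refl) (simp add: scaleR_conv_of_real)
  ultimately have "((\<lambda>u. complex_of_real (saw_sum N y (c + u) * fejer H u)) has_integral Z) {s..s + 1}"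
    by simp
  from has_integral_linear[OF this bounded_linear_Re]
  have int: "((\<lambda>u. saw_sum N y (c + u) * fejer H u) has_integral Re Z) {s..s + 1}"
    by (simp add: o_def)
  \<comment> \<open>In a row each value \<open>h\<close> of \<open>|j - l|\<close> occurs at most
    twice, once on either side of the diagonal.\<close>
  have row: "norm ((\<Sum>l<H. A (int j - int l)) - A 0) \<le> 2 * (\<Sum>h=1..H. b h)" if j: "j < H" for j
  proof -
    have "(\<Sum>l<H. A (int j - int l)) = A 0 + (\<Sum>l\<in>{..<H} - {j}. A (int j - int l))"
      using j by (subst sum.remove[of _ j]) auto
    then have "norm ((\<Sum>l<H. A (int j - int l)) - A 0) = norm (\<Sum>l\<in>{..<H} - {j}. A (int j - int l))"
      by simp
    also have "\<dots> \<le> (\<Sum>l\<in>{..<H} - {j}. norm (A (int j - int l)))" by (rule norm_sum)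
    also have "\<dots> = (\<Sum>l\<in>{..<H} - {j}. b (nat \<bar>int j - int l\<bar>))"
      by (intro sum.cong refl normA) auto
    also have "{..<H} - {j} = {..<j} \<union> {j<..<H}" using j by auto
    also have "(\<Sum>l\<in>\<dots>. b (nat \<bar>int j - int l\<bar>))
        = (\<Sum>l<j. b (nat \<bar>int j - int l\<bar>)) + (\<Sum>l\<in>{j<..<H}. b (nat \<bar>int j - int l\<bar>))"
      by (intro sum.union_disjoint) auto
    also have "(\<Sum>l<j. b (nat \<bar>int j - int l\<bar>)) = (\<Sum>l<j. b (j - l))"
      by (intro sum.cong refl) (simp flip: of_nat_diff)
    also have "(\<Sum>l<j. b (j - l)) = (\<Sum>h\<in>(\<lambda>l. j - l) ` {..<j}. b h)"
      by (subst sum.reindex) (auto intro: inj_onI)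
    also have "(\<Sum>l\<in>{j<..<H}. b (nat \<bar>int j - int l\<bar>)) = (\<Sum>l\<in>{j<..<H}. b (l - j))"
      by (intro sum.cong refl) (simp add: nat_diff_distrib)
    also have "(\<Sum>l\<in>{j<..<H}. b (l - j)) = (\<Sum>h\<in>(\<lambda>l. l - j) ` {j<..<H}. b h)"
      by (subst sum.reindex) (auto simp: inj_on_def)
    also have "(\<Sum>h\<in>(\<lambda>l. j - l) ` {..<j}. b h) \<le> (\<Sum>h=1..H. b h)"
      using j by (intro sum_mono2) (auto simp: b_def)
    also have "(\<Sum>h\<in>(\<lambda>l. l - j) ` {j<..<H}. b h) \<le> (\<Sum>h=1..H. b h)"
      using j by (intro sum_mono2) (auto simp: b_def)
    finally show ?thesis by simp
  qed
  have "Z - of_real (N / 2) = (1 / H) *\<^sub>R (\<Sum>j<H. (\<Sum>l<H. A (int j - int l)) - A 0)"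
    using assms by (simp add: Z_def A0 sum_subtractf scaleR_sum_right scaleR_diff_right)
      (simp add: scaleR_conv_of_real)
  then have "norm (Z - of_real (N / 2)) = 1 / H * norm (\<Sum>j<H. (\<Sum>l<H. A (int j - int l)) - A 0)"
    by simp
  also have "\<dots> \<le> 1 / H * (\<Sum>j<H. 2 * (\<Sum>h=1..H. b h))"
    by (intro mult_left_mono sum_norm_le row) auto
  also have "\<dots> = (\<Sum>h=1..H. 2 * b h)" using assms by (simp add: sum_distrib_left)
  also have "\<dots> \<le> (\<Sum>h=1..H. norm (exp_sum N y (int h)) / h)"
  proof (intro sum_mono)
    fix h assume "h \<in> {1..H}"
    then have "norm (exp_sum N y (int h)) / (pi * h) \<le> norm (exp_sum N y (int h)) / (1 * h)"
      using pi_gt3 by (intro divide_left_mono mult_right_mono) auto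
    then show "2 * b h \<le> norm (exp_sum N y (int h)) / h" by (simp add: b_def)
  qed
  finally have "norm (Z - of_real (N / 2)) \<le> (\<Sum>h=1..H. norm (exp_sum N y (int h)) / h)" .
  moreover have "\<bar>Re Z - N / 2\<bar> \<le> norm (Z - of_real (N / 2))"
    using abs_Re_le_cmod[of "Z - of_real (N / 2)"] by simp
  ultimately show ?thesis using that int by force
qed

text \<open>Increasing \<open>t\<close> can only lower the floors of \<open>y n - t\<close>, so up
  to the drift \<open>N * t\<close> the function is nondecreasing, like the count behind it.\<close>

lemma saw_sum_mono:
  assumes "s \<le> t"
  shows "saw_sum N y s \<le> saw_sum N y t + N * (t - s)"
proof -
  have "frac (y n - s) \<le> frac (y n - t) + (t - s)" for n
  proof -
    have "\<lfloor>y n - t\<rfloor> \<le> \<lfloor>y n - s\<rfloor>" using assms by (intro floor_mono) auto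
    then show ?thesis by (simp add: frac_def)
  qed
  then have "saw_sum N y s \<le> (\<Sum>n=1..N. frac (y n - t) + (t - s))"
    unfolding saw_sum_def by (intro sum_mono)
  then show ?thesis by (simp add: saw_sum_def sum.distrib)
qed

lemma saw_sum_bounds: "0 \<le> saw_sum N y t" "saw_sum N y t \<le> N"
proof -
  show "0 \<le> saw_sum N y t" unfolding saw_sum_def by (intro sum_nonneg) auto
  have "saw_sum N y t \<le> (\<Sum>n=1..N. 1)"
    unfolding saw_sum_def by (intro sum_mono) (auto intro: less_imp_le frac_lt_1)
  then show "saw_sum N y t \<le> N" by simp
qed

text \<open>Since \<^term>\<open>\<lambda>t. saw_sum N y t + N * t\<close> is nondecreasing, a large (or small) value persists to
  the right (or left), where the kernel concentrated on an interval of length of order \<^term>\<open>1 / H\<close>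
  detects it. The tail of the kernel only costs half of the oscillation.\<close>
lemma erdos_turan_step:
  assumes H: "H \<ge> 1" and W: "\<And>s t. saw_sum N y s - saw_sum N y t \<le> W"
  shows "saw_sum N y s - saw_sum N y t
    \<le> 2 * (\<Sum>h=1..H. norm (exp_sum N y (int h)) / h) + 128 * N / H + W / 2"
proof -
  \<comment> \<open>With this constant each of the two tails costs at most \<open>W / 4\<close>,
    since \<open>2 * pi / 32 \<le> 1 / 4\<close>.\<close>
  define \<delta> where "\<delta> = 32 / real H"
  define B where "B = (\<Sum>h=1..H. norm (exp_sum N y (int h)) / h)"
  have \<delta>: "\<delta> > 0" using H by (simp add: \<delta>_def)
  have W0: "W \<ge> 0" using W[of 0 0] by simp
  obtain \<tau> where \<tau>: "((\<lambda>u. 2 / (H * (u\<^sup>2 + \<delta>\<^sup>2))) has_integral \<tau>) {-(1/2)..-(1/2) + 1}"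
    "\<tau> \<le> 2 * pi / (H * \<delta>)" by (rule fejer_tail_integral[OF \<delta> H])
  have "2 * pi / (H * \<delta>) \<le> 1 / 4" using H pi_less_4 by (simp add: \<delta>_def)
  with \<tau> have \<tau>4: "\<tau> \<le> 1 / 4" by linarith
  have tail: "W * (if \<bar>u\<bar> \<le> \<delta> then 0 else fejer H u) \<le> W * (2 / (H * (u\<^sup>2 + \<delta>\<^sup>2)))"
    if "u \<in> {-(1/2)..-(1/2) + 1}" for u
    using that fejer_tail[of \<delta> u H] \<delta> H W0 by (intro mult_left_mono) auto
  \<comment> \<open>The kernel is centred at \<open>s + \<delta>\<close>, so that its core lies to
    the right of \<open>s\<close>, and for the upper bound at \<open>t - \<delta>\<close>, with the
    core to the left of \<open>t\<close>. On the core the drift costs at most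
    \<open>2 * N * \<delta>\<close>; outside it the trivial bound \<open>W\<close> is used.\<close>
  obtain R1 where R1: "((\<lambda>u. saw_sum N y (s + \<delta> + u) * fejer H u) has_integral R1) {-(1/2)..-(1/2) + 1}"
    "\<bar>R1 - N / 2\<bar> \<le> B" unfolding B_def by (rule fejer_saw_sum[OF H])
  obtain R2 where R2: "((\<lambda>u. saw_sum N y (t - \<delta> + u) * fejer H u) has_integral R2) {-(1/2)..-(1/2) + 1}"
    "\<bar>R2 - N / 2\<bar> \<le> B" unfolding B_def by (rule fejer_saw_sum[OF H])
  note FI = fejer_has_integral[OF H, of "-(1/2)"]
  have "(saw_sum N y s - 2 * N * \<delta>) * 1 - W * \<tau> \<le> R1"
  proof (rule has_integral_le)
    show "((\<lambda>u. (saw_sum N y s - 2 * N * \<delta>) * fejer H u - W * (2 / (H * (u\<^sup>2 + \<delta>\<^sup>2)))) has_integral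
      ((saw_sum N y s - 2 * N * \<delta>) * 1 - W * \<tau>)) {-(1/2)..-(1/2) + 1}"
      by (intro has_integral_diff has_integral_mult_right FI \<tau>)
    fix u :: real assume u: "u \<in> {-(1/2)..-(1/2) + 1}"
    have "saw_sum N y s - 2 * N * \<delta> - (if \<bar>u\<bar> \<le> \<delta> then 0 else W) \<le> saw_sum N y (s + \<delta> + u)"
    proof (cases "\<bar>u\<bar> \<le> \<delta>")
      case True
      then have "saw_sum N y s \<le> saw_sum N y (s + \<delta> + u) + N * (s + \<delta> + u - s)"
        by (intro saw_sum_mono) auto
      moreover have "N * (s + \<delta> + u - s) \<le> N * (2 * \<delta>)"
        using True by (intro mult_left_mono) auto
      ultimately show ?thesis using True by simp
    next
      case False
      have "0 \<le> 2 * N * \<delta>" using \<delta> by simp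
      with W[of s "s + \<delta> + u"] show ?thesis unfolding if_not_P[OF False] by linarith
    qed
    then have "(saw_sum N y s - 2 * N * \<delta> - (if \<bar>u\<bar> \<le> \<delta> then 0 else W)) * fejer H u
        \<le> saw_sum N y (s + \<delta> + u) * fejer H u"
      by (intro mult_right_mono fejer_nonneg)
    then show "(saw_sum N y s - 2 * N * \<delta>) * fejer H u - W * (2 / (H * (u\<^sup>2 + \<delta>\<^sup>2)))
        \<le> saw_sum N y (s + \<delta> + u) * fejer H u"
      using tail[OF u] by (auto simp: left_diff_distrib split: if_splits)
  qed (fact R1)
  moreover have "R2 \<le> (saw_sum N y t + 2 * N * \<delta>) * 1 + W * \<tau>"
  proof (rule has_integral_le)
    show "((\<lambda>u. (saw_sum N y t + 2 * N * \<delta>) * fejer H u + W * (2 / (H * (u\<^sup>2 + \<delta>\<^sup>2)))) has_integral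
      ((saw_sum N y t + 2 * N * \<delta>) * 1 + W * \<tau>)) {-(1/2)..-(1/2) + 1}"
      by (intro has_integral_add has_integral_mult_right FI \<tau>)
    fix u :: real assume u: "u \<in> {-(1/2)..-(1/2) + 1}"
    have "saw_sum N y (t - \<delta> + u) \<le> saw_sum N y t + 2 * N * \<delta> + (if \<bar>u\<bar> \<le> \<delta> then 0 else W)"
    proof (cases "\<bar>u\<bar> \<le> \<delta>")
      case True
      then have "saw_sum N y (t - \<delta> + u) \<le> saw_sum N y t + N * (t - (t - \<delta> + u))"
        by (intro saw_sum_mono) auto
      moreover have "N * (t - (t - \<delta> + u)) \<le> N * (2 * \<delta>)"
        using True by (intro mult_left_mono) auto
      ultimately show ?thesis using True by simp
    next
      case False
      have "0 \<le> 2 * N * \<delta>" using \<delta> by simp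
      with W[of "t - \<delta> + u" t] show ?thesis unfolding if_not_P[OF False] by linarith
    qed
    then have "saw_sum N y (t - \<delta> + u) * fejer H u
        \<le> (saw_sum N y t + 2 * N * \<delta> + (if \<bar>u\<bar> \<le> \<delta> then 0 else W)) * fejer H u"
      by (intro mult_right_mono fejer_nonneg)
    then show "saw_sum N y (t - \<delta> + u) * fejer H u
        \<le> (saw_sum N y t + 2 * N * \<delta>) * fejer H u + W * (2 / (H * (u\<^sup>2 + \<delta>\<^sup>2)))"
      using tail[OF u] by (auto simp: distrib_right split: if_splits)
  qed (fact R2)
  moreover have "W * \<tau> \<le> W * (1 / 4)" by (intro mult_left_mono \<tau>4 W0)
  moreover have "4 * N * \<delta> = 128 * N / H" by (simp add: \<delta>_def)
  ultimately show ?thesis using R1(2) R2(2) unfolding B_def[symmetric] by (simp add: abs_le_iff)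
qed

text \<open>The preceding step applies with \<open>W\<close> the supremum of all differences, which
  is finite because they are bounded by \<open>N\<close>; then \<open>W / 2\<close> is absorbed on
  the left.\<close>

lemma erdos_turan:
  assumes H: "H \<ge> 1"
  shows "saw_sum N y s - saw_sum N y t
    \<le> 4 * (\<Sum>h=1..H. norm (exp_sum N y (int h)) / h) + 256 * N / H"
proof -
  define f where "f p = saw_sum N y (fst p) - saw_sum N y (snd p)" for p
  have bdd: "bdd_above (range f)"
  proof (rule bdd_aboveI[of _ "real N"])
    fix x assume "x \<in> range f"
    then obtain p where "x = f p" by auto
    then show "x \<le> real N"
      using saw_sum_bounds(2)[of N y "fst p"] saw_sum_bounds(1)[of N y "snd p"] by (simp add: f_def)
  qed
  have W: "saw_sum N y s - saw_sum N y t \<le> Sup (range f)" for s t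
    using cSUP_upper[OF _ bdd, of "(s, t)"] by (simp add: f_def)
  have "Sup (range f) \<le> 2 * (\<Sum>h=1..H. norm (exp_sum N y (int h)) / h) + 128 * N / H + Sup (range f) / 2"
  proof (rule cSUP_least)
    fix p
    show "f p \<le> 2 * (\<Sum>h=1..H. norm (exp_sum N y (int h)) / h) + 128 * N / H + Sup (range f) / 2"
      using erdos_turan_step[OF H W, of "fst p" "snd p"] by (simp add: f_def)
  qed simp
  with W[of s t] show ?thesis by simp
qed

section \<open>The star-discrepancy in terms of the sawtooth sum\<close>

lemma count_below_frac:
  assumes "0 < \<beta>" "\<beta> \<le> 1"
  shows "real (count_below N (\<lambda>n. frac (y n)) \<beta>) - N * \<beta> = saw_sum N y \<beta> - saw_sum N y 0"
proof -
  \<comment> \<open>Subtracting \<open>\<beta>\<close> wraps a point around exactly when its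
    fractional part lies below \<open>\<beta>\<close>.\<close>
  have *: "frac (y n - \<beta>) - frac (y n) = (if frac (y n) < \<beta> then 1 else 0) - \<beta>" for n
  proof (cases "frac (y n) < \<beta>")
    case True
    have int: "y n - \<beta> - (frac (y n) + 1 - \<beta>) \<in> \<int>" by (simp add: frac_def)
    have "0 \<le> frac (y n)" by simp
    with True assms have "frac (y n - \<beta>) = frac (y n) + 1 - \<beta>"
      unfolding frac_unique_iff by (intro conjI int) linarith+
    then show ?thesis using True by simp
  next
    case False
    have int: "y n - \<beta> - (frac (y n) - \<beta>) \<in> \<int>" by (simp add: frac_def)
    have "frac (y n) < 1" by (rule frac_lt_1)
    with False assms have "frac (y n - \<beta>) = frac (y n) - \<beta>"
      unfolding frac_unique_iff by (intro conjI int) linarith+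
    then show ?thesis using False by simp
  qed
  have "{n. 1 \<le> n \<and> n \<le> N \<and> frac (y n) \<in> {0..<\<beta>}} = {n \<in> {1..N}. frac (y n) < \<beta>}"
    by auto
  then have "real (count_below N (\<lambda>n. frac (y n)) \<beta>) = (\<Sum>n=1..N. if frac (y n) < \<beta> then 1 else 0)"
    by (simp add: count_below_def sum.If_cases Int_def)
  then have "real (count_below N (\<lambda>n. frac (y n)) \<beta>) - N * \<beta> = (\<Sum>n=1..N. (if frac (y n) < \<beta> then 1 else 0) - \<beta>)"
    by (simp add: sum_subtractf)
  also have "\<dots> = saw_sum N y \<beta> - saw_sum N y 0"
    by (simp add: saw_sum_def * flip: sum_subtractf)
  finally show ?thesis .
qed

lemma star_discrepancy_saw:
  assumes "N \<ge> 1" "0 < \<beta>" "\<beta> \<le> 1"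
  shows "\<bar>real (count_below N (\<lambda>n. frac (y n)) \<beta>) / real N - \<beta>\<bar> = \<bar>saw_sum N y \<beta> - saw_sum N y 0\<bar> / N"
proof -
  have "real (count_below N (\<lambda>n. frac (y n)) \<beta>) / real N - \<beta>
      = (saw_sum N y \<beta> - saw_sum N y 0) / N"
    using assms by (simp add: field_simps flip: count_below_frac)
  then show ?thesis by (simp add: abs_divide)
qed

lemma star_discrepancy_le:
  assumes "N \<ge> 1" and W: "\<And>s t. saw_sum N y s - saw_sum N y t \<le> W"
  shows "N * star_discrepancy N (\<lambda>n. frac (y n)) \<le> W"
proof -
  have "star_discrepancy N (\<lambda>n. frac (y n)) \<le> W / N"
    unfolding star_discrepancy_def
  proof (rule cSUP_least)
    fix \<beta> :: real assume "\<beta> \<in> {0<..1}"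
    then have "\<bar>real (count_below N (\<lambda>n. frac (y n)) \<beta>) / real N - \<beta>\<bar> = \<bar>saw_sum N y \<beta> - saw_sum N y 0\<bar> / N"
      using assms by (intro star_discrepancy_saw) auto
    also have "\<dots> \<le> W / N"
      using W[of \<beta> 0] W[of 0 \<beta>] by (intro divide_right_mono) auto
    finally show "\<bar>real (count_below N (\<lambda>n. frac (y n)) \<beta>) / real N - \<beta>\<bar> \<le> W / N" .
  qed auto
  then show ?thesis using assms by (simp add: field_simps)
qed

lemma saw_sum_le_star_discrepancy:
  assumes "N \<ge> 1" "t \<in> {0..1}"
  shows "\<bar>saw_sum N y t - saw_sum N y 0\<bar> \<le> N * star_discrepancy N (\<lambda>n. frac (y n))"
proof -
  let ?D = "\<lambda>\<beta>. \<bar>real (count_below N (\<lambda>n. frac (y n)) \<beta>) / real N - \<beta>\<bar>"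
  have bound: "?D \<beta> \<le> 1" if "\<beta> \<in> {0<..1}" for \<beta>
  proof -
    have "?D \<beta> = \<bar>saw_sum N y \<beta> - saw_sum N y 0\<bar> / N"
      using that assms by (intro star_discrepancy_saw) auto
    also have "\<dots> \<le> real N / N"
      using saw_sum_bounds[of N y \<beta>] saw_sum_bounds[of N y 0] by (intro divide_right_mono) auto
    finally show ?thesis using assms by simp
  qed
  have bdd: "bdd_above (?D ` {0<..1})"
    using bound by (intro bdd_aboveI[of _ 1]) auto
  have le: "\<bar>saw_sum N y \<beta> - saw_sum N y 0\<bar> / N \<le> star_discrepancy N (\<lambda>n. frac (y n))"
    if "\<beta> \<in> {0<..1}" for \<beta>
    unfolding star_discrepancy_def
    using cSUP_upper[OF that bdd] that assms by (subst star_discrepancy_saw[symmetric]) auto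
  \<comment> \<open>The point \<open>t = 0\<close> is outside the range of the supremum; there
    nonnegativity suffices.\<close>
  have "0 \<le> star_discrepancy N (\<lambda>n. frac (y n))"
    using le[of 1] by (rule order_trans[rotated]) auto
  then show ?thesis
    using le[of t] assms by (cases "t = 0") (auto simp: field_simps)
qed

lemma exp_sum_le_star_discrepancy:
  assumes "N \<ge> 1" "h \<noteq> 0"
  shows "norm (exp_sum N y h) \<le> 2 * pi * \<bar>real_of_int h\<bar> * (N * star_discrepancy N (\<lambda>n. frac (y n)))"
  by (intro koksma_exp_sum saw_sum_le_star_discrepancy assms)

section \<open>The upper bound\<close>

text \<open>On a unit interval the series of the \<open>g k\<close> has finite integral, hence
  converges almost everywhere, and its terms tend to 0. Countably many such intervals cover the
  line.\<close>

lemma AE_tendsto_0_of_summable_integrals: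
  fixes g :: "nat \<Rightarrow> real \<Rightarrow> real"
  assumes cont: "\<And>k. continuous_on UNIV (g k)" and nonneg: "\<And>k x. 0 \<le> g k x"
    and int: "\<And>k t. integral {t..t + 1} (g k) \<le> b k" and sum: "summable b"
  shows "AE x in lborel. (\<lambda>k. g k x) \<longlonglongrightarrow> 0"
proof -
  have b0: "0 \<le> b k" for k
    using integral_nonneg[of "g k" "{0..0 + 1}"] int[of 0 k] nonneg
      integrable_continuous_interval[OF continuous_on_subset[OF cont], of "0" "0 + 1" k] by force
  have 1: "AE x in lborel. x \<in> {t..t + 1} \<longrightarrow> (\<lambda>k. g k x) \<longlonglongrightarrow> 0" for t
  proof -
    define f where "f k x = ennreal (indicator {t..t + 1} x * g k x)" for k x
    have meas: "f k \<in> borel_measurable lborel" for k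
    proof -
      have "g k \<in> borel_measurable borel" by (rule borel_measurable_continuous_onI[OF cont])
      then show ?thesis unfolding f_def[abs_def] by measurable
    qed
    have "integral\<^sup>N lborel (f k) \<le> ennreal (b k)" for k
    proof -
      have "(g k has_integral integral {t..t + 1} (g k)) {t..t + 1}"
        by (intro integrable_integral integrable_continuous_interval continuous_on_subset[OF cont]) auto
      from nn_integral_has_integral_lebesgue[OF nonneg this]
      have "integral\<^sup>N lborel (f k) = ennreal (integral {t..t + 1} (g k))"
        by (simp add: f_def[abs_def])
      also have "\<dots> \<le> ennreal (b k)" by (intro ennreal_leI int)
      finally show ?thesis .
    qed
    then have "(\<Sum>k. integral\<^sup>N lborel (f k)) \<le> (\<Sum>k. ennreal (b k))"
      by (intro suminf_le) auto
    also have "\<dots> = ennreal (\<Sum>k. b k)" by (intro suminf_ennreal2 b0 sum)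
    also have "\<dots> < \<infinity>" by simp
    finally have "(\<Sum>k. integral\<^sup>N lborel (f k)) \<noteq> \<infinity>" by simp
    moreover have "integral\<^sup>N lborel (\<lambda>x. \<Sum>k. f k x) = (\<Sum>k. integral\<^sup>N lborel (f k))"
      by (rule nn_integral_suminf[OF meas])
    ultimately have "AE x in lborel. (\<Sum>k. f k x) \<noteq> \<infinity>"
      by (intro nn_integral_noteq_infinite) (use meas in auto)
    then show ?thesis
    proof eventually_elim
      case (elim x)
      show ?case
      proof
        assume "x \<in> {t..t + 1}"
        then have "f k x = ennreal (g k x)" for k by (simp add: f_def)
        with elim have "summable (\<lambda>k. g k x)"
          by (intro summable_suminf_not_top nonneg) auto
        then show "(\<lambda>k. g k x) \<longlonglongrightarrow> 0" by (rule summable_LIMSEQ_zero)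
      qed
    qed
  qed
  then have "AE x in lborel. \<forall>j::int. x \<in> {of_int j..of_int j + 1} \<longrightarrow> (\<lambda>k. g k x) \<longlonglongrightarrow> 0"
    unfolding AE_all_countable by blast
  then show ?thesis
  proof eventually_elim
    case (elim x)
    have "x \<in> {of_int \<lfloor>x\<rfloor>..of_int \<lfloor>x\<rfloor> + 1}" by (auto intro: less_imp_le)
    with elim show ?case by blast
  qed
qed

section \<open>Dyadic blocks and the maximal inequality\<close>

text \<open>Collects the dyadic blocks from which, as in the proof of the Rademacher--Menshov inequality, all
  partial sums are composed.\<close>
primrec dyadic_squares :: "(nat \<Rightarrow> complex) \<Rightarrow> nat \<Rightarrow> nat \<Rightarrow> real" where
  "dyadic_squares f 0 s = (norm (f s))\<^sup>2"
| "dyadic_squares f (Suc k) s =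
     dyadic_squares f k s + dyadic_squares f k (s + 2 ^ k) + (norm (\<Sum>n=s..<s + 2 ^ k. f n))\<^sup>2"

lemma dyadic_squares_nonneg: "0 \<le> dyadic_squares f k s"
  by (induction k arbitrary: s) auto

text \<open>A partial sum uses at most one block of each length, so Cauchy-Schwarz costs only the
  number of levels. As the right side is free of \<open>N\<close>, all partial sums are controlled
  at once.\<close>

lemma norm_partial_sum_le_dyadic_squares:
  assumes "N \<le> 2 ^ k"
  shows "(norm (\<Sum>n=s..<s + N. f n))\<^sup>2 \<le> (real k + 1) * dyadic_squares f k s"
  using assms
proof (induction k arbitrary: s N)
  case 0
  then have "N = 0 \<or> N = 1" by auto
  then show ?case by auto
next
  case (Suc k)
  let ?D = "dyadic_squares f" and ?S = "(norm (\<Sum>n=s..<s + 2 ^ k. f n))\<^sup>2"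
  show ?case
  proof (cases "N \<le> 2 ^ k")
    case True
    have "(norm (\<Sum>n=s..<s + N. f n))\<^sup>2 \<le> (real k + 1) * ?D k s" by (rule Suc.IH[OF True])
    also have "\<dots> \<le> (real (Suc k) + 1) * ?D (Suc k) s"
      by (intro mult_mono) (auto simp: dyadic_squares_nonneg)
    finally show ?thesis .
  next
    case False
    define M where "M = N - 2 ^ k"
    have N: "N = 2 ^ k + M" "M \<le> 2 ^ k" using False Suc.prems by (auto simp: M_def)
    define A where "A = norm (\<Sum>n=s..<s + 2 ^ k. f n)"
    define E where "E = norm (\<Sum>n=s + 2 ^ k..<s + 2 ^ k + M. f n)"
    have IH: "E\<^sup>2 \<le> (real k + 1) * ?D k (s + 2 ^ k)" unfolding E_def by (rule Suc.IH[OF N(2)])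
    have "(\<Sum>n=s..<s + N. f n) = (\<Sum>n=s..<s + 2 ^ k. f n) + (\<Sum>n=s + 2 ^ k..<s + 2 ^ k + M. f n)"
      unfolding N(1) by (subst sum.atLeastLessThan_concat) (auto simp: add.assoc)
    then have "norm (\<Sum>n=s..<s + N. f n) \<le> A + E"
      unfolding A_def E_def by (metis norm_triangle_ineq)
    then have "(norm (\<Sum>n=s..<s + N. f n))\<^sup>2 \<le> (A + E)\<^sup>2"
      by (intro power_mono) auto
    \<comment> \<open>Cauchy-Schwarz with weights 1 and \<open>k + 1\<close>, chosen so that the
      factor of the induction hypothesis grows only from \<open>k + 1\<close> to
      \<open>k + 2\<close>.\<close>
    also have "(A + E)\<^sup>2 \<le> (real k + 2) * (A\<^sup>2 + E\<^sup>2 / (real k + 1))"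
    proof -
      have "0 \<le> ((real k + 1) * A - E)\<^sup>2 / (real k + 1)" by simp
      also have "\<dots> = (real k + 2) * (A\<^sup>2 + E\<^sup>2 / (real k + 1)) - (A + E)\<^sup>2"
        by (simp add: field_simps power2_eq_square)
      finally show ?thesis by simp
    qed
    also have "\<dots> \<le> (real k + 2) * (A\<^sup>2 + ?D k (s + 2 ^ k))"
      using IH by (intro mult_left_mono add_left_mono) (auto simp: field_simps)
    also have "\<dots> \<le> (real (Suc k) + 1) * ?D (Suc k) s"
      by (intro mult_mono) (auto simp: dyadic_squares_nonneg A_def)
    finally show ?thesis .
  qed
qed

lemma continuous_on_dyadic_squares:
  "continuous_on A (\<lambda>x. dyadic_squares (\<lambda>n. e1 (of_int (l n) * x)) k s)"
  by (induction k arbitrary: s) (auto intro!: continuous_intros)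

text \<open>Distinct frequencies are orthonormal, so a block contributes its length; each of the
  \<open>k + 1\<close> levels contributes at most \<open>2 ^ k\<close>.\<close>

lemma integral_dyadic_squares_le:
  assumes "inj_on l {s..<s + 2 ^ k}"
  shows "integral {t..t + 1} (\<lambda>x. dyadic_squares (\<lambda>n. e1 (of_int (l n) * x)) k s) \<le> (real k + 1) * 2 ^ k"
  using assms
proof (induction k arbitrary: s)
  case 0
  then show ?case by simp
next
  case (Suc k)
  let ?f = "\<lambda>n x. e1 (of_int (l n) * x)"
  have inj: "inj_on l {s..<s + 2 ^ k}" "inj_on l {s + 2 ^ k..<s + 2 ^ k + 2 ^ k}"
    using Suc.prems by (auto elim!: inj_on_subset)
  have "integral {t..t + 1} (\<lambda>x. dyadic_squares (\<lambda>n. ?f n x) (Suc k) s)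
      = integral {t..t + 1} (\<lambda>x. dyadic_squares (\<lambda>n. ?f n x) k s)
      + integral {t..t + 1} (\<lambda>x. dyadic_squares (\<lambda>n. ?f n x) k (s + 2 ^ k))
      + integral {t..t + 1} (\<lambda>x. (norm (\<Sum>n=s..<s + 2 ^ k. ?f n x))\<^sup>2)"
    unfolding dyadic_squares.simps
    by (subst Henstock_Kurzweil_Integration.integral_add;
        (intro integrable_continuous_interval continuous_intros continuous_on_dyadic_squares)?)+ simp
  also have "integral {t..t + 1} (\<lambda>x. (norm (\<Sum>n=s..<s + 2 ^ k. ?f n x))\<^sup>2) \<le> 2 ^ k"
  proof -
    have "real (card {i \<in> {s..<s + 2 ^ k}. l i = v}) \<le> 1" for v
    proof -
      have "card {i \<in> {s..<s + 2 ^ k}. l i = v} \<le> Suc 0"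
        using inj(1) by (subst card_le_Suc0_iff_eq) (auto simp: inj_on_def)
      then show ?thesis by simp
    qed
    from integral_norm_exp_sum_le[where c = "\<lambda>_. 1", OF _ this, of t] show ?thesis by simp
  qed
  also note Suc.IH[OF inj(1)]
  also note Suc.IH[OF inj(2)]
  finally have "integral {t..t + 1} (\<lambda>x. dyadic_squares (\<lambda>n. ?f n x) (Suc k) s)
      \<le> (real k + 1) * 2 ^ k + (real k + 1) * 2 ^ k + 2 ^ k" by simp
  also have "\<dots> \<le> (real (Suc k) + 1) * 2 ^ Suc k" by (simp add: algebra_simps)
  finally show ?case .
qed

lemma sum_inverse_le_power2: "(\<Sum>h=1..2 ^ k. 1 / real h) \<le> real k + 1"
proof (induction k)
  case (Suc k)
  have "(\<Sum>h=1..2 ^ Suc k. 1 / real h) = (\<Sum>h=1..2 ^ k. 1 / real h) + (\<Sum>h=2 ^ k + 1..2 ^ Suc k. 1 / real h)"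
    by (subst sum.union_disjoint[symmetric]) (auto intro!: sum.cong)
  also have "(\<Sum>h=2 ^ k + 1..2 ^ Suc k. 1 / real h) \<le> (\<Sum>h=(2::nat) ^ k + 1..2 ^ Suc k. 1 / 2 ^ k :: real)"
  proof (intro sum_mono divide_left_mono)
    fix h :: nat assume "h \<in> {2 ^ k + 1..2 ^ Suc k}"
    then have "2 ^ k \<le> h" by simp
    then have "real (2 ^ k) \<le> real h" by (rule of_nat_mono)
    then show "2 ^ k \<le> real h" by simp
  qed auto
  also have "\<dots> = 1" by simp
  finally show ?case using Suc by simp
qed simp

text \<open>The weights \<^term>\<open>1 / h\<close> are those of the inequality of Erdos and Turan.\<close>
definition weighted_squares :: "(nat \<Rightarrow> int) \<Rightarrow> nat \<Rightarrow> real \<Rightarrow> real" where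
  "weighted_squares a k x = (\<Sum>h=1..2 ^ k. dyadic_squares (\<lambda>n. e1 (of_int (int h * a n) * x)) k 1 / h)"

lemma weighted_squares_nonneg: "0 \<le> weighted_squares a k x"
  unfolding weighted_squares_def by (intro sum_nonneg divide_nonneg_nonneg dyadic_squares_nonneg) auto

lemma continuous_on_weighted_squares: "continuous_on A (weighted_squares a k)"
  unfolding weighted_squares_def[abs_def] by (intro continuous_intros continuous_on_dyadic_squares) auto

lemma integral_weighted_squares_le:
  assumes "inj_on a {1..}"
  shows "integral {t..t + 1} (weighted_squares a k) \<le> (real k + 1)\<^sup>2 * 2 ^ k"
proof -
  have "integral {t..t + 1} (weighted_squares a k)
      = (\<Sum>h=1..2 ^ k. integral {t..t + 1} (\<lambda>x. dyadic_squares (\<lambda>n. e1 (of_int (int h * a n) * x)) k 1) / h)"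
    unfolding weighted_squares_def[abs_def]
    by (subst integral_sum) (auto simp del: of_int_mult intro!: integrable_continuous_interval continuous_intros continuous_on_dyadic_squares)
  also have "\<dots> \<le> (\<Sum>h=1..2 ^ k. ((real k + 1) * 2 ^ k) / real h)"
  proof (intro sum_mono divide_right_mono integral_dyadic_squares_le)
    fix h :: nat assume "h \<in> {1..2 ^ k}"
    then show "inj_on (\<lambda>n. int h * a n) {1..<1 + 2 ^ k}"
      using assms by (auto simp: inj_on_def)
  qed auto
  also have "\<dots> = (real k + 1) * 2 ^ k * (\<Sum>h=1..2 ^ k. 1 / real h)"
    by (simp add: sum_distrib_left)
  also have "\<dots> \<le> (real k + 1) * 2 ^ k * (real k + 1)"
    by (intro mult_left_mono sum_inverse_le_power2) auto
  finally show ?thesis by (simp add: power2_eq_square mult_ac)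
qed

text \<open>The inequality of Erdos and Turan with \<open>H = 2 ^ k\<close>, whose remainder
  \<open>256 * N / H\<close> is then bounded, combined with the maximal inequality for each
  frequency.\<close>

lemma star_discrepancy_le_weighted_squares:
  assumes N: "1 \<le> N" "N \<le> 2 ^ k"
  shows "N * star_discrepancy N (\<lambda>n. frac (of_int (a n) * x)) \<le> 4 * (real k + 1) * sqrt (weighted_squares a k x) + 256"
proof (rule star_discrepancy_le[OF N(1)])
  fix s t
  define S where "S h = norm (exp_sum N (\<lambda>n. of_int (a n) * x) (int h))" for h
  have S: "(S h)\<^sup>2 \<le> (real k + 1) * dyadic_squares (\<lambda>n. e1 (of_int (int h * a n) * x)) k 1" for h
  proof -
    have "exp_sum N (\<lambda>n. of_int (a n) * x) (int h) = (\<Sum>n=1..<1 + N. e1 (of_int (int h * a n) * x))"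
      by (simp add: exp_sum_def atLeastLessThanSuc_atLeastAtMost mult_ac)
    then show ?thesis unfolding S_def using norm_partial_sum_le_dyadic_squares[OF N(2)] by metis
  qed
  \<comment> \<open>The weight is split evenly, so that Cauchy-Schwarz produces the harmonic sum, of
    size at most \<open>k + 1\<close>, and the weighted squares.\<close>
  have "(\<Sum>h=1..2 ^ k. S h / h)\<^sup>2 = (\<Sum>h=1..2 ^ k. (1 / sqrt h) * (S h / sqrt h))\<^sup>2"
    by (simp add: real_sqrt_mult_self)
  also have "\<dots> \<le> (\<Sum>h=1..2 ^ k. (1 / sqrt (real h))\<^sup>2) * (\<Sum>h=1..2 ^ k. (S h / sqrt h)\<^sup>2)"
    by (rule Cauchy_Schwarz_ineq_sum)
  also have "\<dots> = (\<Sum>h=1..2 ^ k. 1 / real h) * (\<Sum>h=1..2 ^ k. (S h)\<^sup>2 / h)"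
    by (simp add: power_divide)
  also have "\<dots> \<le> (real k + 1) * ((real k + 1) * weighted_squares a k x)"
    unfolding weighted_squares_def sum_distrib_left
  proof (intro mult_mono sum_mono)
    fix h :: nat
    show "(S h)\<^sup>2 / h \<le> (real k + 1) * (dyadic_squares (\<lambda>n. e1 (of_int (int h * a n) * x)) k 1 / h)"
      using divide_right_mono[OF S[of h], of h] by simp
  qed (use sum_inverse_le_power2[of k] in \<open>auto intro!: sum_nonneg\<close>)
  finally have "(\<Sum>h=1..2 ^ k. S h / h)\<^sup>2 \<le> ((real k + 1) * sqrt (weighted_squares a k x))\<^sup>2"
    by (simp add: power_mult_distrib weighted_squares_nonneg power2_eq_square mult_ac)
  then have "(\<Sum>h=1..2 ^ k. S h / h) \<le> (real k + 1) * sqrt (weighted_squares a k x)"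
    by (rule power2_le_imp_le) (simp add: weighted_squares_nonneg)
  moreover have "saw_sum N (\<lambda>n. of_int (a n) * x) s - saw_sum N (\<lambda>n. of_int (a n) * x) t
      \<le> 4 * (\<Sum>h=1..2 ^ k. S h / h) + 256 * N / (2 ^ k)"
    using erdos_turan[of "2 ^ k" N "\<lambda>n. of_int (a n) * x" s t] by (simp add: S_def)
  moreover have "256 * real N / (2 ^ k) \<le> 256"
  proof -
    have "real N \<le> real (2 ^ k)" using N by (intro of_nat_mono)
    then show ?thesis by (simp add: field_simps)
  qed
  ultimately show "saw_sum N (\<lambda>n. of_int (a n) * x) s - saw_sum N (\<lambda>n. of_int (a n) * x) t
      \<le> 4 * (real k + 1) * sqrt (weighted_squares a k x) + 256" by linarith
qed

text \<open>\<open>N\<close> is rounded up to a power \<open>2 ^ k\<close>. The square root of the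
  weighted squares uses up half of the \<open>\<epsilon>\<close>, and the other half absorbs the
  factor \<open>k + 1\<close>.\<close>

lemma bigO_all_star_discrepancy:
  fixes \<epsilon> :: real
  assumes \<epsilon>: "\<epsilon> > 0" and lim: "(\<lambda>k. weighted_squares a k x / 2 powr (k * (1 + \<epsilon>))) \<longlonglongrightarrow> 0"
  shows "bigO_all (\<lambda>N. real N * star_discrepancy N (\<lambda>n. frac (real_of_int (a n) * x))) (\<lambda>N. real N powr (1/2 + \<epsilon>))"
proof -
  obtain M where M: "M > 0" "\<And>k. norm (weighted_squares a k x / 2 powr (k * (1 + \<epsilon>))) \<le> M"
    using convergent_imp_Bseq[OF convergentI[OF lim]] by (auto simp: Bseq_def)
  have "(\<lambda>k. (real k + 1) / 2 powr (k * (\<epsilon> / 2))) \<longlonglongrightarrow> 0"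
    using \<epsilon> by real_asymp
  from convergent_imp_Bseq[OF convergentI[OF this]]
  obtain L where L: "L > 0" "\<And>k. norm ((real k + 1) / 2 powr (k * (\<epsilon> / 2))) \<le> L"
    by (auto simp: Bseq_def)
  \<comment> \<open>The last factor pays for \<open>2 ^ k \<le> 2 * N\<close>.\<close>
  define C where "C = (4 * L * sqrt M + 256) * 2 powr (1/2 + \<epsilon>)"
  have "real N * star_discrepancy N (\<lambda>n. frac (real_of_int (a n) * x)) \<le> C * real N powr (1/2 + \<epsilon>)"
    if N: "N \<ge> 1" for N
  proof -
    obtain k where k: "N \<le> 2 ^ k" "2 ^ k \<le> 2 * N"
    proof (cases "N = 1")
      case True
      then show ?thesis using that[of 0] by simp
    next
      case False
      define k where "k = (LEAST k. N \<le> 2 ^ k)"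
      have 1: "N \<le> 2 ^ k" unfolding k_def by (rule LeastI[of _ N]) (simp add: less_imp_le)
      then obtain j where j: "k = Suc j" using False N by (cases k) auto
      then have "\<not> N \<le> 2 ^ j" using not_less_Least[of j "\<lambda>k. N \<le> 2 ^ k"] by (simp add: k_def)
      then show ?thesis using that[of k] 1 j by simp
    qed
    have ws: "weighted_squares a k x \<le> M * 2 powr (k * (1 + \<epsilon>))"
      using M(2)[of k] weighted_squares_nonneg[of a k x] by (simp add: field_simps)
    have "real k + 1 \<le> L * 2 powr (k * (\<epsilon> / 2))"
      using L(2)[of k] by (simp add: field_simps)
    moreover have "sqrt (weighted_squares a k x) \<le> sqrt M * 2 powr (k * (1 + \<epsilon>) / 2)"
    proof -
      have "sqrt (weighted_squares a k x) \<le> sqrt (M * 2 powr (k * (1 + \<epsilon>)))"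
        using ws by simp
      also have "\<dots> = sqrt M * 2 powr (k * (1 + \<epsilon>) / 2)"
        by (simp add: real_sqrt_mult powr_half_sqrt[symmetric] powr_powr)
      finally show ?thesis .
    qed
    ultimately have "(real k + 1) * sqrt (weighted_squares a k x)
        \<le> (L * 2 powr (k * (\<epsilon> / 2))) * (sqrt M * 2 powr (k * (1 + \<epsilon>) / 2))"
      using L M by (intro mult_mono) (auto simp: weighted_squares_nonneg)
    also have "\<dots> = L * sqrt M * 2 powr (k * (\<epsilon> / 2) + k * (1 + \<epsilon>) / 2)"
      by (simp add: powr_add)
    also have "k * (\<epsilon> / 2) + k * (1 + \<epsilon>) / 2 = k * (1/2 + \<epsilon>)"
      by (simp add: field_simps)
    finally have "(real k + 1) * sqrt (weighted_squares a k x) \<le> L * sqrt M * 2 powr (k * (1/2 + \<epsilon>))" .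
    moreover have "1 \<le> 2 powr (k * (1/2 + \<epsilon>))"
      using \<epsilon> by (intro ge_one_powr_ge_zero) auto
    ultimately have "4 * (real k + 1) * sqrt (weighted_squares a k x) + 256
        \<le> 4 * L * sqrt M * 2 powr (k * (1/2 + \<epsilon>)) + 256 * 2 powr (k * (1/2 + \<epsilon>))"
      unfolding mult.assoc by linarith
    also have "\<dots> = (4 * L * sqrt M + 256) * (2 ^ k) powr (1/2 + \<epsilon>)"
      by (simp add: powr_powr distrib_right flip: powr_realpow)
    also have "\<dots> \<le> (4 * L * sqrt M + 256) * (2 * N) powr (1/2 + \<epsilon>)"
    proof (intro mult_left_mono powr_mono2)
      have "real (2 ^ k) \<le> real (2 * N)" using k by (intro of_nat_mono)
      then show "2 ^ k \<le> real (2 * N)" by simp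
    qed (use \<epsilon> L M in auto)
    also have "\<dots> = C * real N powr (1/2 + \<epsilon>)" by (simp add: C_def powr_mult)
    finally show ?thesis using star_discrepancy_le_weighted_squares[OF N k(1), of a x] by linarith
  qed
  then show ?thesis unfolding bigO_all_def by blast
qed

lemma bigO_all_powr_mono:
  assumes "bigO_all f (\<lambda>N. real N powr p)" "p \<le> q"
  shows "bigO_all f (\<lambda>N. real N powr q)"
proof -
  obtain C where C: "\<And>N. N \<ge> 1 \<Longrightarrow> f N \<le> C * real N powr p"
    using assms by (auto simp: bigO_all_def)
  have "f N \<le> \<bar>C\<bar> * real N powr q" if "N \<ge> 1" for N
  proof -
    have "f N \<le> \<bar>C\<bar> * real N powr p"
      by (rule order_trans[OF C[OF that]]) (auto intro: mult_right_mono)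
    also have "\<dots> \<le> \<bar>C\<bar> * real N powr q"
      using that assms by (intro mult_left_mono powr_mono) auto
    finally show ?thesis .
  qed
  then show ?thesis by (auto simp: bigO_all_def)
qed

text \<open>For fixed \<open>\<epsilon>\<close> the mean of the weighted squares is at most of order
  \<open>k^2 * 2^k\<close>, which division by \<open>2 powr (k * (1 + \<epsilon>))\<close> makes
  summable. To get one null set for all \<open>\<epsilon>\<close>, only the countably many values
  \<open>1 / Suc j\<close> are treated; larger ones follow by monotonicity.\<close>

theorem AE_star_discrepancy_upper:
  assumes inj: "inj_on a {1..}"
  shows "AE x in lborel. \<forall>\<epsilon>>0. bigO_all
    (\<lambda>N. real N * star_discrepancy N (\<lambda>n. frac (real_of_int (a n) * x))) (\<lambda>N. real N powr (1/2 + \<epsilon>))"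
proof -
  have "AE x in lborel. (\<lambda>k. weighted_squares a k x / 2 powr (k * (1 + \<epsilon>))) \<longlonglongrightarrow> 0"
    if "\<epsilon> > 0" for \<epsilon> :: real
  proof (rule AE_tendsto_0_of_summable_integrals)
    show "continuous_on UNIV (\<lambda>x. weighted_squares a k x / 2 powr (k * (1 + \<epsilon>)))" for k
      by (intro continuous_intros continuous_on_weighted_squares) auto
    show "0 \<le> weighted_squares a k x / 2 powr (k * (1 + \<epsilon>))" for k x
      by (simp add: weighted_squares_nonneg)
    show "integral {t..t + 1} (\<lambda>x. weighted_squares a k x / 2 powr (k * (1 + \<epsilon>)))
        \<le> ((real k + 1)\<^sup>2 * 2 powr k) / 2 powr (k * (1 + \<epsilon>))" for k t
      using integral_weighted_squares_le[OF inj, of t k]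
      by (simp add: divide_right_mono powr_realpow)
    have "(\<lambda>k. ((real k + 1)\<^sup>2 * 2 powr k) / 2 powr (k * (1 + \<epsilon>))) \<in> O(\<lambda>k. real k powr - 2)"
      using that by real_asymp
    then show "summable (\<lambda>k. ((real k + 1)\<^sup>2 * 2 powr k) / 2 powr (k * (1 + \<epsilon>)))"
      by (rule summable_comparison_test_bigo[rotated]) (simp add: summable_real_powr_iff)
  qed
  then have "AE x in lborel. \<forall>j. (\<lambda>k. weighted_squares a k x / 2 powr (k * (1 + 1 / Suc j))) \<longlonglongrightarrow> 0"
    unfolding AE_all_countable by simp
  then show ?thesis
  proof eventually_elim
    case (elim x)
    show ?case
    proof (intro allI impI)
      fix \<epsilon> :: real assume "\<epsilon> > 0"
      then obtain j where j: "1 / Suc j < \<epsilon>" using nat_approx_posE by blast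
      have "bigO_all (\<lambda>N. real N * star_discrepancy N (\<lambda>n. frac (real_of_int (a n) * x)))
          (\<lambda>N. real N powr (1/2 + 1 / Suc j))"
        by (rule bigO_all_star_discrepancy[OF _ elim[rule_format]]) simp
      then show "bigO_all (\<lambda>N. real N * star_discrepancy N (\<lambda>n. frac (real_of_int (a n) * x)))
          (\<lambda>N. real N powr (1/2 + \<epsilon>))"
        by (rule bigO_all_powr_mono) (use j in simp)
    qed
  qed
qed

section \<open>Prime numbers\<close>

text \<open>The entries \<^term>\<open>1 / (k * (n choose k))\<close> of the Leibniz harmonic triangle are differences of
  neighbouring entries, starting from \<^term>\<open>1 / n\<close>.\<close>
lemma mult_binomial_dvd_common_multiple:
  fixes L :: nat
  assumes "\<And>m. 1 \<le> m \<Longrightarrow> m \<le> n \<Longrightarrow> m dvd L" "1 \<le> k" "k \<le> n"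
  shows "k * (n choose k) dvd L"
proof -
  have "real L / real (k * (n choose k)) \<in> \<int>"
    using assms(2,3,1)
  proof (induction k arbitrary: n rule: dec_induct)
    case base
    then obtain c where "L = n * c" by (metis dvdE order_refl)
    with base show ?case by simp
  next
    case (step k)
    have 1: "real L / real (k * (n choose k)) \<in> \<int>"
      using step by (intro step.IH) auto
    have 2: "real L / real (k * ((n - 1) choose k)) \<in> \<int>"
      using step by (intro step.IH) auto
    define C where "C = real (n choose k)"
    have C: "C > 0" using step.prems by (simp add: C_def)
    have "real (Suc k * (n choose Suc k)) = real (n * ((n - 1) choose k))"
      by (simp only: binomial_absorption)
    moreover have nk: "real n * real ((n - 1) choose k) = (real n - real k) * C"
      using step.prems binomial_absorb_comp[of n k, THEN arg_cong[of _ _ real]]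
      by (simp add: C_def of_nat_diff)
    ultimately have Suc: "real (Suc k * (n choose Suc k)) = (real n - real k) * C"
      by simp
    have n1: "real ((n - 1) choose k) = (real n - real k) * C / n"
      using nk step.prems by (simp add: field_simps)
    have "real L / real (Suc k * (n choose Suc k))
        = real L / real (k * ((n - 1) choose k)) - real L / real (k * (n choose k))"
    proof -
      \<comment> \<open>The rule of the Leibniz triangle, with \<open>d\<close> in place of
        \<open>n - k\<close> and \<open>k + d\<close> in place of \<open>n\<close>.\<close>
      have "real L / (d * C) = real L / (k * (d * C / (k + d))) - real L / (k * C)" if "d > 0" for d :: real
        using that C step.hyps by (simp add: divide_simps) (simp add: algebra_simps)
      from this[of "real n - real k"] show ?thesis
        unfolding Suc unfolding of_nat_mult n1 C_def[symmetric] using step.prems by simp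
    qed
    with 1 2 show ?case by (simp only: Ints_diff)
  qed
  then obtain z where z: "real L / real (k * (n choose k)) = of_int z" by (auto elim: Ints_cases)
  have "real (k * (n choose k)) \<noteq> 0" using assms by simp
  then have "of_int (int L) = (of_int (z * int (k * (n choose k))) :: real)"
    using z by (simp add: field_simps)
  then have "int L = z * int (k * (n choose k))" by (simp only: of_int_eq_iff)
  then have "int (k * (n choose k)) dvd int L" by simp
  then show ?thesis by (simp only: int_dvd_int_iff)
qed

text \<open>A bound of Chebyshev type. The least common multiple \<open>L\<close> of the numbers up
  to \<open>2 * m\<close> is a product of prime powers that are each at most \<open>2 * m\<close>,
  yet it is divisible by \<open>m * ((2 * m) choose m)\<close>, which is at least
  \<open>2 ^ m\<close>.\<close>

lemma power2_le_prime_count: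
  assumes "m \<ge> 1"
  shows "2 ^ m \<le> (2 * m) ^ card {p::nat. prime p \<and> p \<le> 2 * m}"
proof -
  define P where "P = {p::nat. prime p \<and> p \<le> 2 * m}"
  define e where "e p = (GREATEST i. p ^ i \<le> 2 * m)" for p :: nat
  define L where "L = (\<Prod>p\<in>P. p ^ e p)"
  have fin: "finite P" unfolding P_def by (rule finite_subset[of _ "{..2 * m}"]) auto
  have bound: "i \<le> 2 * m" if "prime p" "p ^ i \<le> 2 * m" for p i :: nat
  proof -
    have "i < 2 ^ i" by simp
    also have "2 ^ i \<le> p ^ i" using that prime_ge_2_nat by (intro power_mono) auto
    finally show ?thesis using that by simp
  qed
  have e: "p ^ e p \<le> 2 * m" if "prime p" for p
    unfolding e_def by (rule GreatestI_nat[of _ 0 "2 * m"]) (use assms bound that in auto)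
  have e_ge: "i \<le> e p" if "prime p" "p ^ i \<le> 2 * m" for i p
    unfolding e_def by (rule Greatest_le_nat[of _ _ "2 * m"]) (use bound that in auto)
  have L: "n dvd L" if "1 \<le> n" "n \<le> 2 * m" for n
  proof -
    have "n = (\<Prod>p\<in>prime_factors n. p ^ multiplicity p n)"
      using that prod_prime_factors[of n] by simp
    also have "\<dots> dvd L"
      unfolding L_def
    proof (rule prod_dvd_prod_subset2[OF fin])
      show "prime_factors n \<subseteq> P"
      proof
        fix p assume "p \<in> prime_factors n"
        then have "prime p" "p dvd n" by (auto simp: in_prime_factors_iff)
        moreover have "p \<le> n" using that \<open>p dvd n\<close> by (intro dvd_imp_le) auto
        ultimately show "p \<in> P" using that by (simp add: P_def)
      qed
      fix p assume p: "p \<in> prime_factors n"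
      have "p ^ multiplicity p n \<le> n"
        using that by (intro dvd_imp_le multiplicity_dvd) auto
      then show "p ^ multiplicity p n dvd p ^ e p"
        using p that by (intro le_imp_power_dvd e_ge) auto
    qed
    finally show ?thesis .
  qed
  have Lpos: "L > 0" using fin by (auto simp: L_def P_def prime_gt_0_nat intro!: prod_pos)
  have "real (2 ^ m) \<le> real (m * ((2 * m) choose m))"
  proof -
    have "(2::real) ^ m \<le> 2 ^ m * 2 ^ m / 2"
      using assms self_le_power[of "2::real" m] by (simp add: field_simps)
    also have "\<dots> = m * (4 ^ m / (2 * m))" using assms by (simp flip: power_mult_distrib)
    also have "\<dots> \<le> m * real ((2 * m) choose m)"
      using central_binomial_lower_bound[of m] assms by (intro mult_left_mono) auto
    finally show ?thesis by simp
  qed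
  then have "2 ^ m \<le> m * ((2 * m) choose m)" by (simp only: of_nat_le_iff)
  also have "\<dots> \<le> L"
    using assms by (intro dvd_imp_le[OF _ Lpos] mult_binomial_dvd_common_multiple[OF L]) auto
  also have "\<dots> \<le> (\<Prod>p\<in>P. 2 * m)"
    unfolding L_def by (intro prod_mono) (auto simp: P_def e)
  also have "\<dots> = (2 * m) ^ card P" by simp
  finally show ?thesis by (simp add: P_def)
qed

text \<open>The case \<open>m = 2 ^ j\<close> of the preceding bound makes both sides powers of 2,
  whose exponents are compared.\<close>

lemma prime_count_power2:
  "2 ^ j \<le> Suc j * card {p::nat. prime p \<and> p \<le> 2 ^ Suc j}"
proof -
  define c where "c = card {p::nat. prime p \<and> p \<le> 2 ^ Suc j}"
  have "(2::nat) ^ (2 ^ j) \<le> (2 ^ Suc j) ^ c"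
    using power2_le_prime_count[of "2 ^ j"] by (simp add: c_def)
  also have "\<dots> = 2 ^ (Suc j * c)" by (simp only: power_mult)
  finally show ?thesis unfolding c_def by (rule power_le_imp_le_exp[rotated]) simp
qed

text \<open>Each prime divisor contributes a factor of at least 2 to the factorisation.\<close>

lemma card_prime_divisors_le:
  fixes n :: nat
  assumes "n > 0" "\<And>p. p \<in> F \<Longrightarrow> prime p \<and> p dvd n"
  shows "2 ^ card F \<le> n"
proof -
  have "2 ^ card F \<le> (2::nat) ^ card (prime_factors n)"
    using assms by (intro power_increasing card_mono) (auto simp: in_prime_factors_iff)
  also have "\<dots> = (\<Prod>p\<in>prime_factors n. 2)" by simp
  also have "\<dots> \<le> (\<Prod>p\<in>prime_factors n. p ^ multiplicity p n)"
  proof (intro prod_mono conjI)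
    fix p assume p: "p \<in> prime_factors n"
    have "2 \<le> p ^ 1" using p prime_ge_2_nat by (auto simp: in_prime_factors_iff)
    also have "\<dots> \<le> p ^ multiplicity p n"
      using p prime_ge_2_nat[of p] by (intro power_increasing)
        (auto simp: in_prime_factors_iff prime_factors_multiplicity Suc_le_eq)
    finally show "2 \<le> p ^ multiplicity p n" .
  qed auto
  also have "\<dots> = n" using assms prod_prime_factors[of n] by simp
  finally show ?thesis .
qed

section \<open>The lower bound\<close>

definition diff_count :: "int set \<Rightarrow> int \<Rightarrow> nat" where
  "diff_count A d = card {(u, v). u \<in> A \<and> v \<in> A \<and> u - v = d}"

text \<open>The difference 0 is left out because it carries the mean value \<open>card A\<close> of
  the squared exponential sum; the rest is the oscillating part.\<close>

definition nonzero_diffs :: "int set \<Rightarrow> int set" where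
  "nonzero_diffs A = (\<lambda>(u, v). u - v) ` (A \<times> A) - {0}"

text \<open>Two representations of the same difference form a quadruple counted by the
  energy.\<close>

lemma sum_diff_count_squares_le:
  assumes A: "finite A"
  shows "(\<Sum>d\<in>nonzero_diffs A. (diff_count A d)\<^sup>2) \<le> additive_energy A"
proof -
  define R where "R d = {(u, v). u \<in> A \<and> v \<in> A \<and> u - v = d}" for d
  define E where "E = {(x1, x2, x3, x4). x1 \<in> A \<and> x2 \<in> A \<and> x3 \<in> A \<and> x4 \<in> A \<and> x1 - x2 = x3 - x4}"
  have finR: "finite (R d)" for d
    by (rule finite_subset[of _ "A \<times> A"]) (use A in \<open>auto simp: R_def\<close>)
  have finE: "finite E"
    by (rule finite_subset[of _ "A \<times> A \<times> A \<times> A"]) (use A in \<open>auto simp: E_def\<close>)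
  have finD: "finite (nonzero_diffs A)" using A by (simp add: nonzero_diffs_def)
  have "(\<Sum>d\<in>nonzero_diffs A. (diff_count A d)\<^sup>2) = (\<Sum>d\<in>nonzero_diffs A. card (R d \<times> R d))"
    by (simp add: diff_count_def R_def power2_eq_square card_cartesian_product)
  also have "\<dots> = card (SIGMA d:nonzero_diffs A. R d \<times> R d)"
    using finR finD by (subst card_SigmaI) auto
  also have "\<dots> \<le> card E"
    by (rule card_inj_on_le[of "\<lambda>(d, (u, v), (w, z)). (u, v, w, z)", OF _ _ finE])
      (auto simp: inj_on_def R_def E_def)
  finally show ?thesis by (simp add: additive_energy_def E_def)
qed

text \<open>Expand the square and group the pairs by their difference.\<close>

lemma norm_square_exp_sum_set:
  assumes A: "finite A"
  shows "complex_of_real ((norm (\<Sum>u\<in>A. e1 (of_int u * z)))\<^sup>2)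
    = card A + (\<Sum>d\<in>nonzero_diffs A. diff_count A d * e1 (of_int d * z))"
proof -
  define g where "g = (\<lambda>(u::int, v). u - v)"
  define h where "h = (\<lambda>p. e1 (of_int (g p) * z))"
  have "complex_of_real ((norm (\<Sum>u\<in>A. e1 (of_int u * z)))\<^sup>2)
      = (\<Sum>u\<in>A. e1 (of_int u * z)) * cnj (\<Sum>u\<in>A. e1 (of_int u * z))"
    by (simp only: complex_norm_square)
  also have "\<dots> = (\<Sum>u\<in>A. \<Sum>v\<in>A. e1 (of_int (u - v) * z))"
    by (simp add: sum_product cis_cnj cis_mult algebra_simps)
  also have "\<dots> = sum h (A \<times> A)"
    by (simp add: sum.cartesian_product h_def g_def split_def)
  also have "\<dots> = (\<Sum>d\<in>g ` (A \<times> A). sum h {p \<in> A \<times> A. g p = d})"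
    using A by (intro sum.image_gen) auto
  also have "\<dots> = (\<Sum>d\<in>g ` (A \<times> A). diff_count A d * e1 (of_int d * z))"
  proof (intro sum.cong refl)
    fix d
    have "sum h {p \<in> A \<times> A. g p = d} = (\<Sum>p\<in>{p \<in> A \<times> A. g p = d}. e1 (of_int d * z))"
      by (intro sum.cong refl) (auto simp: h_def)
    moreover have "{p \<in> A \<times> A. g p = d} = {(u, v). u \<in> A \<and> v \<in> A \<and> u - v = d}"
      by (auto simp: g_def)
    ultimately show "sum h {p \<in> A \<times> A. g p = d} = diff_count A d * e1 (of_int d * z)"
      by (simp add: diff_count_def)
  qed
  also have "\<dots> = card A + (\<Sum>d\<in>nonzero_diffs A. diff_count A d * e1 (of_int d * z))"
  proof (cases "A = {}")
    case False
    then have "0 \<in> g ` (A \<times> A)" by (force simp: g_def)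
    moreover have "diff_count A 0 = card A"
    proof -
      have "{(u, v). u \<in> A \<and> v \<in> A \<and> u - v = 0} = (\<lambda>u. (u, u)) ` A" by auto
      then show ?thesis by (simp add: diff_count_def card_image inj_on_def)
    qed
    ultimately show ?thesis
      using A by (subst sum.remove[of _ 0]) (auto simp: nonzero_diffs_def g_def)
  qed (simp add: nonzero_diffs_def)
  finally show ?thesis .
qed

text \<open>The mean over dilations by primes is close to its expectation: an integer has few prime
  divisors, so hardly any two of the dilated exponential sums correlate.\<close>
lemma integral_prime_dilates_le:
  fixes A :: "int set" and P :: "nat set" and H M :: real
  assumes A: "finite A" and P: "finite P" "\<And>p. p \<in> P \<Longrightarrow> prime p \<and> real p \<le> H"
    and M: "\<And>u v. u \<in> A \<Longrightarrow> v \<in> A \<Longrightarrow> \<bar>real_of_int (u - v)\<bar> \<le> M"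
    and HM: "1 \<le> H * M"
  shows "integral {t..t + 1} (\<lambda>x. (\<Sum>p\<in>P. (norm (\<Sum>u\<in>A. e1 (of_int u * (p * x))))\<^sup>2 - card A)\<^sup>2)
    \<le> log 2 (H * M) * (card P * additive_energy A)"
proof -
  define I where "I = P \<times> nonzero_diffs A"
  define l where "l = (\<lambda>(p, d). int p * d)"
  define c where "c = (\<lambda>(p::nat, d). real (diff_count A d))"
  have finD: "finite (nonzero_diffs A)" using A by (simp add: nonzero_diffs_def)
  have finI: "finite I" using P finD by (simp add: I_def)
  have eq: "\<bar>\<Sum>p\<in>P. (norm (\<Sum>u\<in>A. e1 (of_int u * (p * x))))\<^sup>2 - card A\<bar>
      = norm (\<Sum>i\<in>I. c i * e1 (of_int (l i) * x))" for x :: real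
  proof -
    have "complex_of_real (\<Sum>p\<in>P. (norm (\<Sum>u\<in>A. e1 (of_int u * (p * x))))\<^sup>2 - card A)
        = (\<Sum>p\<in>P. \<Sum>d\<in>nonzero_diffs A. diff_count A d * e1 (of_int d * (p * x)))"
      unfolding of_real_sum of_real_diff norm_square_exp_sum_set[OF A] by (simp only: of_real_of_nat_eq add_diff_cancel_left')
    also have "\<dots> = (\<Sum>i\<in>I. c i * e1 (of_int (l i) * x))"
      unfolding I_def sum.cartesian_product by (intro sum.cong refl) (auto simp: c_def l_def mult_ac)
    finally show ?thesis unfolding norm_of_real[symmetric, where 'a = complex] by (simp only:)
  qed
  \<comment> \<open>Since \<open>v\<close> and \<open>p\<close> determine \<open>d\<close>, the
    multiplicity of \<open>v\<close> is at most the number of primes in \<open>P\<close> dividing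
    it. As \<open>v\<close> is nonzero and at most \<open>H * M\<close> in absolute value, 2 to the
    power of that number is at most \<open>H * M\<close>.\<close>
  have mult: "real (card {i \<in> I. l i = v}) \<le> log 2 (H * M)" if v: "v \<in> l ` I" for v
  proof -
    obtain p d where pd: "p \<in> P" "d \<in> nonzero_diffs A" "v = int p * d"
      using v by (auto simp: I_def l_def)
    have d: "d \<noteq> 0" "\<bar>real_of_int d\<bar> \<le> M" using pd M by (auto simp: nonzero_diffs_def)
    have p: "p > 0" "real p \<le> H" using P(2)[OF pd(1)] by (auto simp: prime_gt_0_nat)
    define n where "n = nat \<bar>v\<bar>"
    have n: "n > 0" using pd d p by (auto simp: n_def)
    have "real n = real p * \<bar>real_of_int d\<bar>" by (simp add: n_def pd abs_mult)
    also have "\<dots> \<le> H * M" using p d by (intro mult_mono) auto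
    finally have nHM: "real n \<le> H * M" .
    have "card {i \<in> I. l i = v} \<le> card {p \<in> P. p dvd n}"
    proof (rule card_inj_on_le)
      show "inj_on fst {i \<in> I. l i = v}"
        using P(2)[of 0] by (auto simp: inj_on_def I_def l_def)
      show "fst ` {i \<in> I. l i = v} \<subseteq> {p \<in> P. p dvd n}"
        by (auto simp: I_def l_def n_def nat_abs_mult_distrib)
    qed (use P in auto)
    moreover have "2 ^ card {p \<in> P. p dvd n} \<le> n"
      using n P by (intro card_prime_divisors_le) auto
    ultimately have "2 ^ card {i \<in> I. l i = v} \<le> n"
      by (meson le_trans one_le_numeral power_increasing)
    then have "real (2 ^ card {i \<in> I. l i = v}) \<le> real n" by (simp only: of_nat_le_iff)
    moreover have "2 powr real (card {i \<in> I. l i = v}) = real (2 ^ card {i \<in> I. l i = v})"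
      by (simp add: powr_realpow)
    ultimately have "2 powr real (card {i \<in> I. l i = v}) \<le> H * M" using nHM by linarith
    moreover have "H * M > 0" using n nHM by simp
    ultimately show ?thesis by (simp add: le_log_iff)
  qed
  have log0: "0 \<le> log 2 (H * M)" using HM by simp
  have "integral {t..t + 1} (\<lambda>x. (\<Sum>p\<in>P. (norm (\<Sum>u\<in>A. e1 (of_int u * (p * x))))\<^sup>2 - card A)\<^sup>2)
      = integral {t..t + 1} (\<lambda>x. (norm (\<Sum>i\<in>I. c i * e1 (of_int (l i) * x)))\<^sup>2)"
    by (simp only: eq[symmetric] power2_abs)
  also have "\<dots> \<le> log 2 (H * M) * (\<Sum>i\<in>I. (c i)\<^sup>2)"
    by (rule integral_norm_exp_sum_le[OF finI mult])
  also have "(\<Sum>i\<in>I. (c i)\<^sup>2) = card P * real (\<Sum>d\<in>nonzero_diffs A. (diff_count A d)\<^sup>2)"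
  proof -
    have "(\<Sum>i\<in>I. (c i)\<^sup>2) = (\<Sum>p\<in>P. \<Sum>d\<in>nonzero_diffs A. (real (diff_count A d))\<^sup>2)"
      unfolding I_def sum.cartesian_product by (intro sum.cong refl) (auto simp: c_def)
    then show ?thesis by simp
  qed
  also have "log 2 (H * M) * \<dots> \<le> log 2 (H * M) * (card P * additive_energy A)"
  proof (intro mult_left_mono log0)
    have "real (\<Sum>d\<in>nonzero_diffs A. (diff_count A d)\<^sup>2) \<le> real (additive_energy A)"
      by (simp only: of_nat_le_iff sum_diff_count_squares_le[OF A])
    then show "card P * real (\<Sum>d\<in>nonzero_diffs A. (diff_count A d)\<^sup>2) \<le> card P * additive_energy A"
      unfolding of_nat_mult by (rule mult_left_mono) simp
  qed
  finally show ?thesis .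
qed

section \<open>Large exponential sums at prime dilates\<close>

lemma exp_sum_image:
  assumes "inj_on a {1..N}"
  shows "exp_sum N (\<lambda>n. of_int (a n) * x) (int p) = (\<Sum>u\<in>a ` {1..N}. e1 (of_int u * (p * x)))"
  using assms by (simp add: exp_sum_def sum.reindex mult_ac)

text \<open>Normalised so that convergence to 0 means that the mean of the squared exponential sums
  over the primes up to \<open>H\<close> is asymptotic to \<open>N\<close>.\<close>

definition prime_dilate_deviation :: "(nat \<Rightarrow> int) \<Rightarrow> nat \<Rightarrow> nat \<Rightarrow> real \<Rightarrow> real" where
  "prime_dilate_deviation a N H x =
     (\<Sum>p | prime p \<and> p \<le> H. (norm (exp_sum N (\<lambda>n. of_int (a n) * x) (int p)))\<^sup>2 - N)
       / (card {p. prime p \<and> p \<le> H} * N)"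

lemma finite_primes_le: "finite {p::nat. prime p \<and> p \<le> H}"
  by (rule finite_subset[of _ "{..H}"]) auto

lemma continuous_on_prime_dilate_deviation: "continuous_on A (prime_dilate_deviation a N H)"
proof -
  \<comment> \<open>Multiplying by a constant avoids the nonzero denominator that continuity of a
    quotient would require.\<close>
  have "continuous_on A (\<lambda>x. (\<Sum>p | prime p \<and> p \<le> H. (norm (exp_sum N (\<lambda>n. of_int (a n) * x) (int p)))\<^sup>2 - N)
      * (1 / (card {p. prime p \<and> p \<le> H} * N)))"
    unfolding exp_sum_def by (intro continuous_intros)
  then show ?thesis by (simp add: prime_dilate_deviation_def[abs_def])
qed

text \<open>The mean of the squares is at least \<open>N / 2\<close>, so some prime
  \<open>p \<le> H\<close> attains this value, and Koksma's inequality at frequency \<open>p\<close>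
  loses a factor of at most \<open>2 * pi * H\<close>.\<close>

lemma star_discrepancy_lower:
  assumes N: "N \<ge> 1" and H: "H \<ge> 2" and dev: "\<bar>prime_dilate_deviation a N H x\<bar> \<le> 1 / 2"
  shows "sqrt (N / 2) \<le> 2 * pi * H * (N * star_discrepancy N (\<lambda>n. frac (of_int (a n) * x)))"
proof -
  define P where "P = {p::nat. prime p \<and> p \<le> H}"
  define S where "S p = norm (exp_sum N (\<lambda>n. of_int (a n) * x) (int p))" for p
  have "2 \<in> P" using H two_is_prime_nat by (simp add: P_def)
  then have "P \<noteq> {}" by blast
  moreover have "finite P" unfolding P_def by (rule finite_primes_le)
  ultimately have P: "P \<noteq> {}" "finite P" by simp_all
  have cP: "real (card P) * real N > 0" using P N by (simp add: card_gt_0_iff)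
  have "\<exists>p\<in>P. real N / 2 \<le> (S p)\<^sup>2"
  proof (rule ccontr)
    assume "\<not> ?thesis"
    then have "(\<Sum>p\<in>P. (S p)\<^sup>2 - N) < (\<Sum>p\<in>P. - (real N / 2))"
      using P by (intro sum_strict_mono) auto
    also have "\<dots> = - (1 / 2) * (card P * N)" by simp
    finally have "(\<Sum>p\<in>P. (S p)\<^sup>2 - N) / (card P * N) < - (1 / 2)"
      using cP by (simp add: pos_divide_less_eq)
    moreover have "- (1 / 2) \<le> prime_dilate_deviation a N H x" using dev by linarith
    ultimately show False
      unfolding prime_dilate_deviation_def P_def[symmetric] S_def[symmetric] by linarith
  qed
  then obtain p where p: "p \<in> P" "real N / 2 \<le> (S p)\<^sup>2" by auto
  have p0: "p > 0" "p \<le> H" using p by (auto simp: P_def prime_gt_0_nat)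
  let ?D = "N * star_discrepancy N (\<lambda>n. frac (of_int (a n) * x))"
  have D0: "0 \<le> ?D"
    using saw_sum_le_star_discrepancy[OF N, of 0 "\<lambda>n. of_int (a n) * x"] by simp
  have "sqrt (N / 2) \<le> S p" using p by (intro real_le_lsqrt) (auto simp: S_def)
  also have "\<dots> \<le> 2 * pi * \<bar>real_of_int (int p)\<bar> * ?D"
    unfolding S_def using p0 by (intro exp_sum_le_star_discrepancy N) auto
  also have "\<dots> \<le> 2 * pi * H * ?D"
    using p0 D0 by (intro mult_right_mono mult_left_mono) auto
  finally show ?thesis .
qed

text \<open>Along \<open>N = 2 ^ (q * Suc j)\<close> and \<open>H = 2 ^ Suc j\<close> one has
  \<open>H = N powr (1 / q)\<close>, so the lost factor \<open>H\<close> is at most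
  \<open>N powr \<epsilon>\<close>.\<close>

lemma Omega_inf_star_discrepancy:
  fixes \<epsilon> :: real
  assumes q: "q \<ge> 1" "1 / real q \<le> \<epsilon>"
    and lim: "(\<lambda>j. (prime_dilate_deviation a (2 ^ (q * Suc j)) (2 ^ Suc j) x)\<^sup>2) \<longlonglongrightarrow> 0"
  shows "Omega_inf (\<lambda>N. real N * star_discrepancy N (\<lambda>n. frac (real_of_int (a n) * x))) (\<lambda>N. real N powr (1/2 - \<epsilon>))"
proof -
  define c where "c = 1 / (sqrt 2 * (2 * pi))"
  have "\<forall>\<^sub>F j in sequentially. (prime_dilate_deviation a (2 ^ (q * Suc j)) (2 ^ Suc j) x)\<^sup>2 < 1 / 4"
    using lim by (rule order_tendstoD) simp
  then obtain j0 where j0: "\<And>j. j \<ge> j0 \<Longrightarrow> (prime_dilate_deviation a (2 ^ (q * Suc j)) (2 ^ Suc j) x)\<^sup>2 < 1 / 4"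
    by (auto simp: eventually_sequentially)
  have "\<exists>N>m. c * real N powr (1/2 - \<epsilon>) \<le> real N * star_discrepancy N (\<lambda>n. frac (real_of_int (a n) * x))" for m
  proof -
    \<comment> \<open>Taking \<open>m\<close> into the maximum forces \<open>N > m\<close>, which
      gives infinitely many \<open>N\<close>.\<close>
    define j where "j = max j0 m"
    define N :: nat where "N = 2 ^ (q * Suc j)"
    define H :: nat where "H = 2 ^ Suc j"
    have "m < q * Suc j" using q by (cases q) (auto simp: j_def)
    also have "\<dots> < N" unfolding N_def by (rule less_exp)
    finally have Nm: "m < N" .
    have N1: "N \<ge> 1" by (simp add: N_def)
    have "(prime_dilate_deviation a N H x)\<^sup>2 \<le> (1 / 2)\<^sup>2"
      using j0[of j] by (simp add: j_def N_def H_def power2_eq_square less_imp_le)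
    then have "\<bar>prime_dilate_deviation a N H x\<bar> \<le> 1 / 2"
      by (simp add: abs_le_square_iff[symmetric])
    from star_discrepancy_lower[OF N1 _ this]
    have *: "sqrt (N / 2) \<le> 2 * pi * H * (N * star_discrepancy N (\<lambda>n. frac (of_int (a n) * x)))"
      by (simp add: H_def)
    have HN: "real H = real N powr (1 / q)"
    proof -
      have "real N = 2 powr (q * Suc j)"
        unfolding N_def by (subst powr_realpow) simp_all
      moreover have "real (q * Suc j) * (1 / q) = real (Suc j)" using q by (simp add: field_simps)
      ultimately have "real N powr (1 / q) = 2 powr (Suc j)" by (simp only: powr_powr)
      also have "\<dots> = real H" unfolding H_def by (subst powr_realpow) simp_all
      finally show ?thesis ..
    qed
    have "real N powr (1/2 - \<epsilon>) \<le> real N powr (1/2 - 1 / q)"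
      using N1 q by (intro powr_mono) auto
    also have "\<dots> = sqrt N / real H"
      by (simp add: powr_diff HN powr_half_sqrt)
    finally have "c * real N powr (1/2 - \<epsilon>) \<le> c * (sqrt N / real H)"
      by (intro mult_left_mono) (simp_all add: c_def)
    also have "\<dots> = sqrt (N / 2) / (2 * pi * H)"
      by (simp add: c_def real_sqrt_divide)
    also have "\<dots> \<le> N * star_discrepancy N (\<lambda>n. frac (of_int (a n) * x))"
      using * by (simp add: H_def pos_divide_le_eq mult_ac)
    finally show ?thesis using Nm by blast
  qed
  moreover have "c > 0" by (simp add: c_def)
  ultimately show ?thesis unfolding Omega_inf_def INFM_nat by blast
qed

text \<open>With exponent \<open>1 / (2 * q)\<close> the energy exceeds \<open>N^2\<close> by a
  factor of at most \<open>E * sqrt H\<close>, whereas averaging gains the number of primes, at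
  least \<open>2 ^ j / Suc j\<close>. The bound thus decays like \<open>2 powr (- j / 2)\<close> up
  to powers of \<open>j\<close>.\<close>

lemma integral_prime_dilate_deviation_le:
  fixes q :: nat and C E \<gamma> :: real
  assumes pos: "\<And>n. n \<ge> 1 \<Longrightarrow> a n > 0" and incr: "strict_mono_on {1..} a" and q: "q \<ge> 1"
    and C: "C \<ge> 1" "\<And>n. n \<ge> 1 \<Longrightarrow> real_of_int (a n) \<le> C * exp (\<gamma> * (ln (real n))\<^sup>2)" and \<gamma>: "\<gamma> \<ge> 0"
    and E: "E \<ge> 0" "\<And>N. N \<ge> 1 \<Longrightarrow> real (additive_energy (a ` {1..N})) \<le> E * real N powr (2 + 1 / (2 * q))"
  shows "integral {t..t + 1} (\<lambda>x. (prime_dilate_deviation a (2 ^ (q * Suc j)) (2 ^ Suc j) x)\<^sup>2)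
    \<le> (Suc j + log 2 C + \<gamma> * (q * Suc j * ln 2)\<^sup>2 / ln 2) * (Suc j * E * 2 powr (Suc j / 2) / 2 ^ j)"
proof -
  define N :: nat where "N = 2 ^ (q * Suc j)"
  define H :: nat where "H = 2 ^ Suc j"
  define P where "P = {p::nat. prime p \<and> p \<le> H}"
  define A where "A = a ` {1..N}"
  \<comment> \<open>The growth bound at \<open>N\<close> also bounds all differences within
    \<open>A\<close>, whose elements lie between 1 and \<open>a N\<close>.\<close>
  define M where "M = C * exp (\<gamma> * (ln (real N))\<^sup>2)"
  define K where "K = log 2 (H * M)"
  have N1: "N \<ge> 1" by (simp add: N_def)
  have inj: "inj_on a {1..N}"
    by (rule inj_on_subset[OF strict_mono_on_imp_inj_on[OF incr]]) auto
  have cardA: "card A = N" unfolding A_def card_image[OF inj] by simp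
  have M1: "M \<ge> 1" unfolding M_def using C \<gamma> mult_mono[of 1 C 1 "exp (\<gamma> * (ln (real N))\<^sup>2)"] by simp
  have "1 \<le> real H" unfolding H_def of_nat_power by (rule one_le_power) simp
  then have "1 * 1 \<le> real H * M" using M1 by (intro mult_mono) auto
  then have HM: "1 \<le> real H * M" by simp
  have diff: "\<bar>real_of_int (u - v)\<bar> \<le> M" if "u \<in> A" "v \<in> A" for u v
  proof -
    have *: "0 < w \<and> w \<le> a N" if "w \<in> A" for w
      using that pos N1 strict_mono_on_leD[OF incr] by (auto simp: A_def)
    have "\<bar>u - v\<bar> \<le> a N" using *[OF that(1)] *[OF that(2)] by linarith
    then have "\<bar>real_of_int (u - v)\<bar> \<le> real_of_int (a N)" by linarith
    also have "\<dots> \<le> M" unfolding M_def by (rule C(2)[OF N1])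
    finally show ?thesis .
  qed
  have K0: "K \<ge> 0" using HM by (simp add: K_def)
  \<comment> \<open>Here the shape of the growth hypothesis matters: the logarithm of
    \<open>M\<close> is only quadratic in \<open>j\<close>, negligible against the number of
    primes.\<close>
  have K: "K = Suc j + log 2 C + \<gamma> * (q * Suc j * ln 2)\<^sup>2 / ln 2"
  proof -
    have "ln (real N) = q * Suc j * ln 2" by (simp add: N_def ln_realpow)
    then have "log 2 (exp (\<gamma> * (ln (real N))\<^sup>2)) = \<gamma> * (q * Suc j * ln 2)\<^sup>2 / ln 2"
      by (simp add: log_def)
    moreover have "log 2 (real H) = Suc j" unfolding H_def of_nat_power by (subst log_nat_power) simp_all
    ultimately show ?thesis
      using C \<open>1 \<le> real H\<close> by (simp add: K_def M_def log_mult)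
  qed
  have "2 ^ j \<le> Suc j * card P" using prime_count_power2[of j] by (simp add: P_def H_def)
  then have "real (2 ^ j) \<le> real (Suc j * card P)" by (simp only: of_nat_le_iff)
  then have P: "2 ^ j \<le> real (Suc j) * real (card P)"
    by (simp only: of_nat_power of_nat_numeral of_nat_mult)
  then have cP: "real (card P) > 0" by (smt (verit) mult_nonneg_nonpos of_nat_0_le_iff zero_less_power)
  have int: "integral {t..t + 1} (\<lambda>x. (\<Sum>p\<in>P. (norm (exp_sum N (\<lambda>n. of_int (a n) * x) (int p)))\<^sup>2 - N)\<^sup>2)
      \<le> K * (card P * additive_energy A)"
  proof -
    have "integral {t..t + 1} (\<lambda>x. (\<Sum>p\<in>P. (norm (\<Sum>u\<in>A. e1 (of_int u * (p * x))))\<^sup>2 - card A)\<^sup>2)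
        \<le> K * (card P * additive_energy A)"
      unfolding K_def
      by (rule integral_prime_dilates_le) (use HM diff finite_primes_le in \<open>auto simp: P_def A_def\<close>)
    then show ?thesis unfolding exp_sum_image[OF inj] A_def[symmetric] cardA .
  qed
  have "integral {t..t + 1} (\<lambda>x. (prime_dilate_deviation a N H x)\<^sup>2)
      = integral {t..t + 1} (\<lambda>x. (\<Sum>p\<in>P. (norm (exp_sum N (\<lambda>n. of_int (a n) * x) (int p)))\<^sup>2 - N)\<^sup>2) / (card P * N)\<^sup>2"
    by (simp add: prime_dilate_deviation_def P_def power_divide)
  also have "\<dots> \<le> K * (card P * additive_energy A) / (card P * N)\<^sup>2"
    by (intro divide_right_mono int) auto
  also have "\<dots> = K * ((additive_energy A / N\<^sup>2) * (1 / card P))"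
    using cP by (simp add: power2_eq_square field_simps)
  also have "\<dots> \<le> K * ((E * 2 powr (Suc j / 2)) * (Suc j / 2 ^ j))"
  proof (intro mult_left_mono mult_mono K0)
    have "real (additive_energy A) \<le> E * real N powr (2 + 1 / (2 * q))"
      unfolding A_def by (rule E(2)[OF N1])
    also have "real N powr (2 + 1 / (2 * q)) = real N ^ 2 * 2 powr (Suc j / 2)"
    proof -
      have "real N = 2 powr (q * Suc j)"
        unfolding N_def by (subst powr_realpow) simp_all
      moreover have "real (q * Suc j) * (1 / (2 * q)) = Suc j / 2" using q by (simp add: field_simps)
      ultimately have "real N powr (1 / (2 * q)) = 2 powr (Suc j / 2)" by (simp only: powr_powr)
      then show ?thesis using N1 by (simp add: powr_add)
    qed
    finally show "additive_energy A / N\<^sup>2 \<le> E * 2 powr (Suc j / 2)"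
      using N1 by (simp add: field_simps)
    show "1 / card P \<le> Suc j / 2 ^ j" using P cP by (simp add: field_simps)
  qed (use E(1) in auto)
  finally show ?thesis unfolding K[symmetric] N_def H_def by (simp add: mult_ac)
qed

text \<open>A constant of at least 2 has a positive logarithm, as the asymptotic estimate in the
  next proof requires.\<close>

lemma bigO_all_obtain:
  assumes "bigO_all f g" "\<And>n. g n \<ge> 0"
  obtains C where "C \<ge> 2" "\<And>n. n \<ge> 1 \<Longrightarrow> f n \<le> C * g n"
proof -
  obtain C where C: "\<And>n. n \<ge> 1 \<Longrightarrow> f n \<le> C * g n"
    using assms(1) by (auto simp: bigO_all_def)
  have "f n \<le> max 2 C * g n" if "n \<ge> 1" for n
    by (rule order_trans[OF C[OF that]]) (auto intro: mult_right_mono assms(2))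
  then show ?thesis by (intro that[of "max 2 C"]) auto
qed

text \<open>For each \<open>q\<close> the mean squares of the deviation are summable over
  \<open>j\<close>, so the deviation tends to 0 almost everywhere.\<close>

theorem AE_star_discrepancy_lower:
  fixes a :: "nat \<Rightarrow> int" and \<gamma> :: real
  assumes pos: "\<And>n. n \<ge> 1 \<Longrightarrow> a n > 0" and incr: "strict_mono_on {1..} a" and \<gamma>: "\<gamma> > 0"
    and growth: "bigO_all (\<lambda>n. real_of_int (a n)) (\<lambda>n. exp (\<gamma> * (ln (real n))\<^sup>2))"
    and energy: "\<And>\<epsilon>::real. \<epsilon> > 0 \<Longrightarrow>
      bigO_all (\<lambda>N. real (additive_energy (a ` {1..N}))) (\<lambda>N. real N powr (2 + \<epsilon>))"
  shows "AE x in lborel. \<forall>\<epsilon>>0. Omega_inf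
    (\<lambda>N. real N * star_discrepancy N (\<lambda>n. frac (real_of_int (a n) * x))) (\<lambda>N. real N powr (1/2 - \<epsilon>))"
proof -
  obtain C where C: "C \<ge> 2" "\<And>n. n \<ge> 1 \<Longrightarrow> real_of_int (a n) \<le> C * exp (\<gamma> * (ln (real n))\<^sup>2)"
    using bigO_all_obtain[OF growth exp_ge_zero] by blast
  have ae: "AE x in lborel. (\<lambda>j. (prime_dilate_deviation a (2 ^ (q * Suc j)) (2 ^ Suc j) x)\<^sup>2) \<longlonglongrightarrow> 0"
    if q: "q \<ge> 1" for q :: nat
  proof -
    have q0: "1 / real (2 * q) > 0" using q by simp
    obtain E where
      E: "E \<ge> 2" "\<And>N. N \<ge> 1 \<Longrightarrow> real (additive_energy (a ` {1..N})) \<le> E * real N powr (2 + 1 / (2 * q))"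
      using bigO_all_obtain[OF energy[OF q0] powr_ge_zero] by blast
    define b where "b j = (real (Suc j) + log 2 C + \<gamma> * (real (q * Suc j) * ln 2)\<^sup>2 / ln 2)
      * (real (Suc j) * E * 2 powr (real (Suc j) / 2) / 2 ^ j)" for j
    show ?thesis
    proof (rule AE_tendsto_0_of_summable_integrals)
      show "integral {t..t + 1} (\<lambda>x. (prime_dilate_deviation a (2 ^ (q * Suc j)) (2 ^ Suc j) x)\<^sup>2) \<le> b j" for j t
        unfolding b_def by (rule integral_prime_dilate_deviation_le[OF pos incr q _ C(2) _ _ E(2)]) (use C E \<gamma> in auto)
      \<comment> \<open>Real parameters of known sign replace \<open>log 2 C\<close>,
        \<open>\<gamma>\<close>, \<open>q\<close> and \<open>E\<close>, because the asymptotics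
        depend on nothing else.\<close>
      have "(\<lambda>j. (real (Suc j) + c + d * (r * real (Suc j) * ln 2)\<^sup>2 / ln 2)
          * (real (Suc j) * e * 2 powr (real (Suc j) / 2) / 2 ^ j)) \<in> O(\<lambda>j. real j powr - 2)"
        if "c > 0" "d > 0" "r > 0" "e > 0" for c d r e :: real
        using that by real_asymp
      then have "b \<in> O(\<lambda>j. real j powr - 2)"
        unfolding b_def[abs_def] of_nat_mult using C(1) E(1) \<gamma> q by simp
      then show "summable b"
        by (rule summable_comparison_test_bigo[rotated]) (simp add: summable_real_powr_iff)
    qed (auto intro!: continuous_intros continuous_on_prime_dilate_deviation)
  qed
  \<comment> \<open>Countably many \<open>q = Suc i\<close> suffice, since some
    \<open>1 / Suc i\<close> lies below any given \<open>\<epsilon>\<close>.\<close>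
  have "AE x in lborel. \<forall>i. (\<lambda>j. (prime_dilate_deviation a (2 ^ (Suc i * Suc j)) (2 ^ Suc j) x)\<^sup>2) \<longlonglongrightarrow> 0"
    unfolding AE_all_countable by (intro allI ae) simp
  then show ?thesis
  proof eventually_elim
    case (elim x)
    show ?case
    proof (intro allI impI)
      fix \<epsilon> :: real assume "\<epsilon> > 0"
      then obtain i where "1 / Suc i < \<epsilon>" using nat_approx_posE by blast
      then show "Omega_inf (\<lambda>N. real N * star_discrepancy N (\<lambda>n. frac (real_of_int (a n) * x)))
          (\<lambda>N. real N powr (1/2 - \<epsilon>))"
        by (intro Omega_inf_star_discrepancy[OF _ _ elim[rule_format, of i]]) auto
    qed
  qed
qed

theorem corollary1:
  fixes a :: "nat \<Rightarrow> int" and \<gamma> :: real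
  assumes pos: "\<And>n. n \<ge> 1 \<Longrightarrow> a n > 0"
    and incr: "strict_mono_on {1..} a"
    and gamma: "\<gamma> > 0"
    and growth: "bigO_all (\<lambda>n. real_of_int (a n)) (\<lambda>n. exp (\<gamma> * (ln (real n))\<^sup>2))"
    and energy: "\<And>\<epsilon>::real. \<epsilon> > 0 \<Longrightarrow>
      bigO_all (\<lambda>N. real (additive_energy (a ` {1..N}))) (\<lambda>N. real N powr (2 + \<epsilon>))"
  shows "AE \<alpha> in lebesgue. \<forall>\<epsilon>::real. \<epsilon> > 0 \<longrightarrow>
      bigO_all (\<lambda>N. real N * star_discrepancy N (\<lambda>n. frac (real_of_int (a n) * \<alpha>)))
        (\<lambda>N. real N powr (1/2 + \<epsilon>)) \<and>
      Omega_inf (\<lambda>N. real N * star_discrepancy N (\<lambda>n. frac (real_of_int (a n) * \<alpha>)))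
        (\<lambda>N. real N powr (1/2 - \<epsilon>))"
proof (rule AE_completion)
  \<comment> \<open>\<open>lebesgue\<close> is the completion of \<open>lborel\<close>, so both
    halves need only be known for the latter.\<close>
  have inj: "inj_on a {1..}" by (rule strict_mono_on_imp_inj_on[OF incr])
  have "AE \<alpha> in lborel. \<forall>\<epsilon>>0. Omega_inf
    (\<lambda>N. real N * star_discrepancy N (\<lambda>n. frac (real_of_int (a n) * \<alpha>))) (\<lambda>N. real N powr (1/2 - \<epsilon>))"
    by (rule AE_star_discrepancy_lower[OF pos incr gamma growth energy])
  with AE_star_discrepancy_upper[OF inj]
  show "AE \<alpha> in lborel. \<forall>\<epsilon>::real. \<epsilon> > 0 \<longrightarrow>
      bigO_all (\<lambda>N. real N * star_discrepancy N (\<lambda>n. frac (real_of_int (a n) * \<alpha>)))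
        (\<lambda>N. real N powr (1/2 + \<epsilon>)) \<and>
      Omega_inf (\<lambda>N. real N * star_discrepancy N (\<lambda>n. frac (real_of_int (a n) * \<alpha>)))
        (\<lambda>N. real N powr (1/2 - \<epsilon>))"
    by eventually_elim blast
qed

end
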